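(* Let $(X_i,Z_i)_{i\ge1}$ be i.i.d. with joint distribution $P_{XZ}$ on finite alphabets $\mathcal{X}\times\mathcal{Z}$, and let $D:\mathcal{X}\times\mathcal{X}\to[0,d_{\max}]$, $d_{\max}<\infty$. When unlimited common randomness is available ($R_0=\infty$), the rate-distortion-perception function with respect to the strong perceptual constraint satisfies \[ R^{(s)}(\Delta,\Pi)\le \inf_{\substack{P_{Y|XZ}:\ \mathbb{E}[D(X,Y)]\le\Delta\\ \limsup_{n\to\infty} d_{\mathrm{TV}}(\prod_{i=1}^nP_X,\prod_{i=1}^nP_Y)\le\Pi}} I(X;Y|Z), \] where the infimum is over conditional distributions of $Y\in\mathcal{X}$ given $(X,Z)\sim P_{XZ}$; moreover, the bound holds with equality when the codes are restricted so that the output sequence $Y^n=g_n(f_n(X^n,Z^n,K),Z^n,K)$ and the side information $Z^n$ are jointly i.i.d.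
   Context: $d_{\mathrm{TV}}(P,Q)=\sup_A|P(A)-Q(A)|$; $\prod_{i=1}^nP_X$ denotes the $n$-fold product of the marginal $P_X$; $D(x^n,y^n)=\frac1n\sum_iD(x_i,y_i)$; $[m]=\{1,\dots,\lfloor m\rfloor\}$. An $(n,2^{nR},2^{nR_0})$ code consists of a (possibly stochastic) encoder $f_n:\mathcal{X}^n\times\mathcal{Z}^n\times[2^{nR_0}]\to[2^{nR}]$ and a (possibly stochastic) decoder $g_n:[2^{nR}]\times\mathcal{Z}^n\times[2^{nR_0}]\to\mathcal{X}^n$, with common randomness $K$ uniform on $[2^{nR_0}]$ independent of $(X^n,Z^n)$ and output $Y^n=g_n(f_n(X^n,Z^n,K),Z^n,K)$. $(R,R_0,\Delta,\Pi)$ is achievable with respect to strong perception if for every $\epsilon>0$ there is a sequence of $(n,2^{n(R+\epsilon)},2^{n(R_0+\epsilon)})$ codes with $\mathbb{E}[D(X^n,Y^n)]\le\Delta+\epsilon$ and $d_{\mathrm{TV}}(P_{X^n},P_{Y^n})\le\Pi+\epsilon$. $R^{(s)}(\Delta,\Pi)$ with $R_0=\infty$ denotes the infimum of rates $R$ such that $(R,R_0,\Delta,\Pi)$ is achievable with respect to strong perception for some (arbitrarily large) $R_0$. *)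

theory Defs
  imports "HOL-Probability.Probability"
begin

fun iid_pmf :: "nat \<Rightarrow> 'a pmf \<Rightarrow> 'a list pmf" where
  "iid_pmf 0 p = return_pmf []"
| "iid_pmf (Suc n) p = bind_pmf p (\<lambda>x. map_pmf (\<lambda>xs. x # xs) (iid_pmf n p))"

definition tv_dist :: "'a pmf \<Rightarrow> 'a pmf \<Rightarrow> real" where
  "tv_dist p q = (SUP A. \<bar>measure_pmf.prob p A - measure_pmf.prob q A\<bar>)"

definition idx :: "real \<Rightarrow> nat set" where
  "idx m = {1..nat \<lfloor>m\<rfloor>}"

(* a (possibly stochastic) code of block length n with message set idx M and
   common-randomness set idx M0:
   encoder f : X^n x Z^n x [M0] -> distributions on [M]
   decoder g : [M] x Z^n x [M0] -> distributions on X^n *)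
definition valid_code ::
  "nat \<Rightarrow> real \<Rightarrow> real \<Rightarrow> ('x list \<Rightarrow> 'z list \<Rightarrow> nat \<Rightarrow> nat pmf)
     \<Rightarrow> (nat \<Rightarrow> 'z list \<Rightarrow> nat \<Rightarrow> 'x list pmf) \<Rightarrow> bool" where
  "valid_code n M M0 f g \<longleftrightarrow>
     idx M0 \<noteq> {} \<and>
     (\<forall>xs zs k. length xs = n \<and> length zs = n \<and> k \<in> idx M0 \<longrightarrow> set_pmf (f xs zs k) \<subseteq> idx M) \<and>
     (\<forall>m zs k. m \<in> idx M \<and> length zs = n \<and> k \<in> idx M0 \<longrightarrow>
        (\<forall>ys \<in> set_pmf (g m zs k). length ys = n))"

definition code_joint ::
  "('x \<times> 'z) pmf \<Rightarrow> nat \<Rightarrow> real \<Rightarrow> ('x list \<Rightarrow> 'z list \<Rightarrow> nat \<Rightarrow> nat pmf)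
     \<Rightarrow> (nat \<Rightarrow> 'z list \<Rightarrow> nat \<Rightarrow> 'x list pmf) \<Rightarrow> ('x list \<times> 'z list \<times> nat \<times> 'x list) pmf" where
  "code_joint P n M0 f g =
     bind_pmf (iid_pmf n P) (\<lambda>xzs.
     bind_pmf (pmf_of_set (idx M0)) (\<lambda>k.
     bind_pmf (f (map fst xzs) (map snd xzs) k) (\<lambda>m.
     map_pmf (\<lambda>ys. (map fst xzs, map snd xzs, k, ys)) (g m (map snd xzs) k))))"

definition code_distortion ::
  "('x \<Rightarrow> 'x \<Rightarrow> real) \<Rightarrow> nat \<Rightarrow> ('x list \<times> 'z list \<times> nat \<times> 'x list) pmf \<Rightarrow> real" where
  "code_distortion D n J =
     measure_pmf.expectation J
       (\<lambda>(xs, zs, k, ys). (1 / real n) * (\<Sum>i<n. D (xs ! i) (ys ! i)))"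

(* (R,R0,Delta,Pi) achievable w.r.t. strong perception; the predicate Q is an
   extra restriction on the induced joint law (True = unrestricted codes) *)
definition achievable_strong ::
  "(nat \<Rightarrow> ('x list \<times> 'z list \<times> nat \<times> 'x list) pmf \<Rightarrow> bool) \<Rightarrow>
   ('x \<times> 'z) pmf \<Rightarrow> ('x \<Rightarrow> 'x \<Rightarrow> real) \<Rightarrow> real \<Rightarrow> real \<Rightarrow> real \<Rightarrow> real \<Rightarrow> bool" where
  "achievable_strong Q P D R R0 Dc Pc \<longleftrightarrow>
     (\<forall>\<epsilon>>0. \<forall>\<^sub>F n in sequentially.
        \<exists>f g. valid_code n (2 powr (real n * (R + \<epsilon>))) (2 powr (real n * (R0 + \<epsilon>))) f g \<and>
          (let J = code_joint P n (2 powr (real n * (R0 + \<epsilon>))) f g in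
             Q n J \<and>
             code_distortion D n J \<le> Dc + \<epsilon> \<and>
             tv_dist (map_pmf (\<lambda>(xs, zs, k, ys). xs) J) (map_pmf (\<lambda>(xs, zs, k, ys). ys) J)
               \<le> Pc + \<epsilon>))"

(* R^(s)(Delta,Pi) with R0 = infinity (extended-real infimum; +inf if nothing achievable) *)
definition RDP_strong ::
  "(nat \<Rightarrow> ('x list \<times> 'z list \<times> nat \<times> 'x list) pmf \<Rightarrow> bool) \<Rightarrow>
   ('x \<times> 'z) pmf \<Rightarrow> ('x \<Rightarrow> 'x \<Rightarrow> real) \<Rightarrow> real \<Rightarrow> real \<Rightarrow> ereal" where
  "RDP_strong Q P D Dc Pc =
     Inf {ereal R | R. \<exists>R0\<ge>0. achievable_strong Q P D R R0 Dc Pc}"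

definition YZ_iid :: "nat \<Rightarrow> ('x list \<times> 'z list \<times> nat \<times> 'x list) pmf \<Rightarrow> bool" where
  "YZ_iid n J \<longleftrightarrow>
     (\<exists>Q :: ('x \<times> 'z) pmf. map_pmf (\<lambda>(xs, zs, k, ys). zip ys zs) J = iid_pmf n Q)"

definition chan_joint :: "('x \<times> 'z) pmf \<Rightarrow> ('x \<Rightarrow> 'z \<Rightarrow> 'y pmf) \<Rightarrow> ('x \<times> 'y \<times> 'z) pmf" where
  "chan_joint P W = bind_pmf P (\<lambda>(x, z). map_pmf (\<lambda>y. (x, y, z)) (W x z))"

definition cond_MI :: "('x \<times> 'y \<times> 'z) pmf \<Rightarrow> real" where
  "cond_MI J = prob_space.conditional_mutual_information (measure_pmf J) 2
      (count_space UNIV) (count_space UNIV) (count_space UNIV)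
      fst (\<lambda>t. fst (snd t)) (\<lambda>t. snd (snd t))"

definition RDP_single_letter ::
  "('x \<times> 'z) pmf \<Rightarrow> ('x \<Rightarrow> 'x \<Rightarrow> real) \<Rightarrow> real \<Rightarrow> real \<Rightarrow> ereal" where
  "RDP_single_letter P D Dc Pc =
     Inf {ereal (cond_MI (chan_joint P W)) | W :: 'x \<Rightarrow> 'z \<Rightarrow> 'x pmf.
           measure_pmf.expectation (chan_joint P W) (\<lambda>(x, y, z). D x y) \<le> Dc \<and>
           limsup (\<lambda>n. ereal (tv_dist (iid_pmf n (map_pmf fst P))
                                     (iid_pmf n (map_pmf (\<lambda>t. fst (snd t)) (chan_joint P W)))))
             \<le> ereal Pc}"

end

theory Submission
  imports Defs
begin

text \<open>
  Achievability. For fixed side information, both parties share a list of about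
  \<open>2^(n(I+\<epsilon>))\<close> independent codewords drawn from the law of \<open>Y^n\<close> given \<open>Z^n\<close>; the encoder performs
  rejection sampling and sends the index of the first accepted codeword. The error is the probability
  that the conditional information density exceeds its mean noticeably, which vanishes by Chebyshev's
  inequality. A uniform mixture of \<open>2^(n R0)\<close> fixed lists, with \<open>R0\<close> larger than \<open>2 log |X|\<close>, replaces the
  random list up to a small error in total variation. Finally the decoder applies a maximal coupling to
  make the law of \<open>(Y^n, Z^n)\<close> exactly i.i.d., which changes the distortion only slightly.

  Converse. Let \<open>Q\<close> be the time average of the laws of \<open>(X_i, Y_i, Z_i)\<close>. Then \<open>n\<close> times the conditional
  information of \<open>Q\<close> is the expectation of the logarithm of a product of likelihood ratios, and a change
  of measure bounds the expectation of that product by the number of messages. As the total variation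
  distance of two product laws tends to 1 unless the factors agree, the perception constraint forces
  the marginal of \<open>Y\<close> to that of \<open>X\<close> (or is void), and compactness gives a limiting channel.
\<close>

subsection \<open>Products of finitely supported distributions\<close>

text \<open>The perception constraint hides a dichotomy. The distance of two n-fold products is
  either 0 for every n or tends to 1, so the limsup condition says that \<open>Pc\<close> is at
  least 1, or that \<open>Pc\<close> is nonnegative and Y has exactly the marginal of X. It then
  holds at every single n, which is the form that codes need.

  A simulated output that is merely close to i.i.d. would fall outside the restricted class.
  Repairing its law exactly costs distortion but no rate, since D is bounded, and the same codes
  then give both the inequality and the equality.

  The bound on the key rate reflects that the fixed lists must reproduce the joint law of
  \<open>(X^n, Y^n)\<close>, which lives on |X|^(2n) points. The alphabet of Z does not enter: both
  terminals know \<open>Z^n\<close>, so every value of it has lists of its own.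

  In the converse, codes have a slack \<epsilon> in rate, distortion and perception while the
  single-letter constraints have none, and the i.i.d. law of (Y, Z) may change with the block
  length. This is why a limit of joint laws is taken, and why conditional information must be
  continuous even where masses vanish.\<close>

lemma expectation_bind_finite:
  fixes h :: "'b \<Rightarrow> real"
  assumes "finite (set_pmf p)" "\<And>x. x \<in> set_pmf p \<Longrightarrow> finite (set_pmf (f x))"
  shows "measure_pmf.expectation (bind_pmf p f) h = measure_pmf.expectation p (\<lambda>x. measure_pmf.expectation (f x) h)"
  using assms by (subst pmf_expectation_bind[of "set_pmf p"])
    (auto simp: integral_measure_pmf[of "set_pmf p"])

lemma expectation_mono_finite:
  fixes h h' :: "'a \<Rightarrow> real"
  assumes "finite (set_pmf p)" "\<And>x. x \<in> set_pmf p \<Longrightarrow> h x \<le> h' x"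
  shows "measure_pmf.expectation p h \<le> measure_pmf.expectation p h'"
  using assms by (intro integral_mono_AE integrable_measure_pmf_finite) (auto simp: AE_measure_pmf_iff)

lemma expectation_add_finite:
  fixes h h' :: "'a \<Rightarrow> real"
  assumes "finite (set_pmf p)"
  shows "measure_pmf.expectation p (\<lambda>x. h x + h' x) = measure_pmf.expectation p h + measure_pmf.expectation p h'"
  by (intro Bochner_Integration.integral_add integrable_measure_pmf_finite assms)

lemma expectation_cong_pmf:
  fixes h h' :: "'a \<Rightarrow> real"
  assumes "\<And>x. x \<in> set_pmf p \<Longrightarrow> h x = h' x"
  shows "measure_pmf.expectation p h = measure_pmf.expectation p h'"
  using assms by (intro integral_cong_AE) (auto simp: AE_measure_pmf_iff)

lemma length_iid_pmf: "xs \<in> set_pmf (iid_pmf n p) \<Longrightarrow> length xs = n"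
  by (induction n arbitrary: xs) auto

lemma finite_lists_of_length: "finite {xs::'a::finite list. length xs = n}"
  using finite_lists_length_eq[of "UNIV :: 'a set" n] by simp

lemma card_lists_of_length: "card {xs::'a::finite list. length xs = n} = CARD('a) ^ n"
  using card_lists_length_eq[of "UNIV :: 'a set" n] by simp

lemma finite_set_iid_pmf: "finite (set_pmf p) \<Longrightarrow> finite (set_pmf (iid_pmf n p))"
  by (induction n) auto

lemma set_iid_pmf: "xs \<in> set_pmf (iid_pmf n p) \<Longrightarrow> set xs \<subseteq> set_pmf p"
  by (induction n arbitrary: xs) fastforce+

lemma iid_pmf_map: "iid_pmf n (map_pmf h p) = map_pmf (map h) (iid_pmf n p)"
  by (induction n) (simp_all add: map_bind_pmf bind_map_pmf map_pmf_comp)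

lemma map_nth_iid_pmf: "i < n \<Longrightarrow> map_pmf (\<lambda>xs. xs ! i) (iid_pmf n p) = p"
proof (induction n arbitrary: i)
  case (Suc n)
  then show ?case
    by (cases i) (simp_all add: map_bind_pmf map_pmf_comp bind_return_pmf')
qed simp

text \<open>Stated for an arbitrary jointly injective constructor, so that one proof covers list
  cells, pairs and the triples of \<open>chan_joint\<close>.\<close>

lemma pmf_bind_map_inj:
  assumes inj: "\<And>x y x' y'. c x y = c x' y' \<longleftrightarrow> x = x' \<and> y = y'"
  shows "pmf (bind_pmf p (\<lambda>x. map_pmf (c x) (F x))) (c a b) = pmf p a * pmf (F a) b"
proof -
  have "pmf (map_pmf (c x) (F x)) (c a b) = (if x = a then pmf (F a) b else 0)" for x
  proof (cases "x = a")
    case True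
    have "inj (c a)" by (simp add: inj_on_def inj)
    then show ?thesis using True pmf_map_inj'[of "c a" "F a" b] by simp
  next
    case False
    then have "c a b \<notin> set_pmf (map_pmf (c x) (F x))" by (auto simp: inj)
    then show ?thesis using False by (simp only: set_pmf_iff) simp
  qed
  then have "pmf (bind_pmf p (\<lambda>x. map_pmf (c x) (F x))) (c a b)
      = measure_pmf.expectation p (\<lambda>x. if x = a then pmf (F a) b else 0)"
    by (simp add: pmf_bind)
  also have "\<dots> = pmf p a * pmf (F a) b"
    by (subst integral_measure_pmf_real[of "{a}"]) (auto split: if_splits)
  finally show ?thesis .
qed

lemmas pmf_bind_map_Cons = pmf_bind_map_inj[of Cons, OF list.inject]
lemmas pmf_bind_map_Pair = pmf_bind_map_inj[of Pair, OF prod.inject]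

lemma pmf_iid_pmf:
  "length xs = n \<Longrightarrow> pmf (iid_pmf n p) xs = (\<Prod>i<n. pmf p (xs ! i))"
proof (induction n arbitrary: xs)
  case (Suc n)
  then obtain a as where "xs = a # as" "length as = n" by (cases xs) auto
  with Suc.IH[of as] show ?case
    by (simp add: pmf_bind_map_Cons prod.lessThan_Suc_shift del: prod.lessThan_Suc)
qed simp

text \<open>Both moments go through one induction, because the cross term of the second vanishes by
  the first.\<close>

lemma variance_sum_list_iid:
  fixes h :: "'a \<Rightarrow> real"
  assumes fin: "finite (set_pmf p)" and mean: "measure_pmf.expectation p h = 0"
  shows "measure_pmf.expectation (iid_pmf n p) (\<lambda>xs. \<Sum>i<n. h (xs ! i)) = 0"
    "measure_pmf.expectation (iid_pmf n p) (\<lambda>xs. (\<Sum>i<n. h (xs ! i))\<^sup>2)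
       = real n * measure_pmf.expectation p (\<lambda>x. (h x)\<^sup>2)"
proof (induction n)
  case (Suc n)
  note f = finite_set_iid_pmf[OF fin, of n]
  let ?S = "\<lambda>xs. \<Sum>i<n. h (xs ! i)"
  {
    case 1
    have "measure_pmf.expectation (iid_pmf (Suc n) p) (\<lambda>xs. \<Sum>i<Suc n. h (xs ! i))
        = measure_pmf.expectation p (\<lambda>x. measure_pmf.expectation (iid_pmf n p) (\<lambda>xs. h x + ?S xs))"
      using f fin by (simp add: expectation_bind_finite sum.lessThan_Suc_shift del: sum.lessThan_Suc)
    then show ?case using Suc.IH(1) mean f by (simp add: expectation_add_finite)
  next
    case 2
    have "measure_pmf.expectation (iid_pmf (Suc n) p) (\<lambda>xs. (\<Sum>i<Suc n. h (xs ! i))\<^sup>2)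
        = measure_pmf.expectation p (\<lambda>x. measure_pmf.expectation (iid_pmf n p) (\<lambda>xs. (h x)\<^sup>2 + (2 * h x * ?S xs + (?S xs)\<^sup>2)))"
      using f fin by (simp add: expectation_bind_finite sum.lessThan_Suc_shift power2_sum algebra_simps del: sum.lessThan_Suc)
    also have "\<dots> = measure_pmf.expectation p (\<lambda>x. (h x)\<^sup>2 + real n * measure_pmf.expectation p (\<lambda>x. (h x)\<^sup>2))"
      using Suc.IH f by (simp add: expectation_add_finite mult.assoc)
    finally show ?case using fin by (simp add: expectation_add_finite algebra_simps)
  }
qed simp_all

lemma iid_Chebyshev:
  fixes h :: "'a \<Rightarrow> real"
  assumes fin: "finite (set_pmf p)" and t: "0 < t"
  defines "\<mu> \<equiv> measure_pmf.expectation p h"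
  shows "measure_pmf.prob (iid_pmf n p) {xs. t \<le> \<bar>(\<Sum>i<n. h (xs ! i)) - real n * \<mu>\<bar>}
    \<le> real n * measure_pmf.expectation p (\<lambda>x. (h x - \<mu>)\<^sup>2) / t\<^sup>2"
proof -
  note f = finite_set_iid_pmf[OF fin, of n]
  let ?h = "\<lambda>x. h x - \<mu>"
  have S: "(\<Sum>i<n. h (xs ! i)) - real n * \<mu> = (\<Sum>i<n. ?h (xs ! i))" for xs
    by (simp add: sum_subtractf)
  have "measure_pmf.expectation p ?h = 0"
    using fin by (simp add: \<mu>_def integrable_measure_pmf_finite)
  from variance_sum_list_iid(2)[OF fin this, of n]
  have V: "measure_pmf.expectation (iid_pmf n p) (\<lambda>xs. (\<Sum>i<n. ?h (xs ! i))\<^sup>2)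
     = real n * measure_pmf.expectation p (\<lambda>x. (?h x)\<^sup>2)" .
  have "t\<^sup>2 * measure_pmf.prob (iid_pmf n p) {xs. t \<le> \<bar>\<Sum>i<n. ?h (xs ! i)\<bar>}
     = measure_pmf.expectation (iid_pmf n p) (\<lambda>xs. t\<^sup>2 * indicator {xs. t \<le> \<bar>\<Sum>i<n. ?h (xs ! i)\<bar>} xs)"
    by simp
  also have "\<dots> \<le> measure_pmf.expectation (iid_pmf n p) (\<lambda>xs. (\<Sum>i<n. ?h (xs ! i))\<^sup>2)"
  proof (rule expectation_mono_finite[OF f])
    fix xs
    have "t\<^sup>2 \<le> (\<Sum>i<n. ?h (xs ! i))\<^sup>2" if "t \<le> \<bar>\<Sum>i<n. ?h (xs ! i)\<bar>"
      using power_mono[OF that, of 2] t by simp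
    then show "t\<^sup>2 * indicator {xs. t \<le> \<bar>\<Sum>i<n. ?h (xs ! i)\<bar>} xs \<le> (\<Sum>i<n. ?h (xs ! i))\<^sup>2"
      by (auto simp: indicator_def)
  qed
  finally have "t\<^sup>2 * measure_pmf.prob (iid_pmf n p) {xs. t \<le> \<bar>(\<Sum>i<n. h (xs ! i)) - real n * \<mu>\<bar>}
     \<le> real n * measure_pmf.expectation p (\<lambda>x. (h x - \<mu>)\<^sup>2)" by (simp only: V S)
  then show ?thesis using t by (simp add: pos_le_divide_eq mult.commute)
qed

section \<open>Total variation distance of product laws\<close>

lemma tv_dist_bdd: "bdd_above (range (\<lambda>A. \<bar>measure_pmf.prob p A - measure_pmf.prob q A\<bar>))"
proof (rule bdd_aboveI2)
  fix A show "\<bar>measure_pmf.prob p A - measure_pmf.prob q A\<bar> \<le> 1"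
    using measure_pmf.prob_le_1[of p A] measure_pmf.prob_le_1[of q A]
      measure_nonneg[of p A] measure_nonneg[of q A] by linarith
qed

lemma tv_dist_ge: "\<bar>measure_pmf.prob p A - measure_pmf.prob q A\<bar> \<le> tv_dist p q"
  unfolding tv_dist_def by (rule cSUP_upper[OF UNIV_I tv_dist_bdd])

lemma tv_dist_le_1: "tv_dist p q \<le> 1"
  unfolding tv_dist_def
proof (rule cSUP_least)
  fix A show "\<bar>measure_pmf.prob p A - measure_pmf.prob q A\<bar> \<le> 1"
    using measure_pmf.prob_le_1[of p A] measure_pmf.prob_le_1[of q A]
      measure_nonneg[of p A] measure_nonneg[of q A] by linarith
qed simp

lemma tv_dist_nonneg: "0 \<le> tv_dist p q"
  using tv_dist_ge[of p "{}" q] by simp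

lemma tv_dist_self: "tv_dist p p = 0"
  by (simp add: tv_dist_def)

text \<open>The number of occurrences of the letter \<open>a\<close> tells the two products apart.
  Its means differ by \<open>2 * t\<close>, so a count within \<open>t\<close> of one mean is at
  least \<open>t\<close> away from the other. Chebyshev makes each of the two errors at most
  \<open>n / t^2 = 4 / (n * (d a)^2)\<close>, whence the 8. The product form also covers
  \<open>d a = 0\<close> and \<open>n = 0\<close>.\<close>

lemma tv_dist_iid_ge:
  fixes p q :: "'a::finite pmf"
  defines "d \<equiv> \<lambda>a. pmf p a - pmf q a"
  shows "(1 - tv_dist (iid_pmf n p) (iid_pmf n q)) * (real n * (d a)\<^sup>2) \<le> 8"
proof (cases "d a = 0 \<or> n = 0")
  case False
  define t where "t = real n * \<bar>d a\<bar> / 2"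
  let ?h = "indicator {a} :: 'a \<Rightarrow> real"
  define A where "A r = {xs. t \<le> \<bar>(\<Sum>i<n. ?h (xs ! i)) - real n * pmf r a\<bar>}" for r :: "'a pmf"
  have t: "0 < t" using False by (simp add: t_def)
  have bd: "measure_pmf.prob (iid_pmf n r) (A r) \<le> real n / t\<^sup>2" for r :: "'a pmf"
  proof -
    have mu: "measure_pmf.expectation r ?h = pmf r a" by (simp add: pmf.rep_eq)
    have "measure_pmf.expectation r (\<lambda>x. (?h x - pmf r a)\<^sup>2) \<le> measure_pmf.expectation r (\<lambda>x. 1)"
    proof (rule expectation_mono_finite)
      fix x show "(?h x - pmf r a)\<^sup>2 \<le> 1"
        using pmf_le_1[of r a] pmf_nonneg[of r a] by (auto simp: indicator_def abs_square_le_1)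
    qed simp
    then have "real n * measure_pmf.expectation r (\<lambda>x. (?h x - pmf r a)\<^sup>2) / t\<^sup>2 \<le> real n / t\<^sup>2"
      by (intro divide_right_mono mult_left_le) auto
    moreover have "measure_pmf.prob (iid_pmf n r) (A r) \<le> real n * measure_pmf.expectation r (\<lambda>x. (?h x - pmf r a)\<^sup>2) / t\<^sup>2"
      using iid_Chebyshev[of r t n ?h] t by (simp only: A_def mu) simp
    ultimately show ?thesis by linarith
  qed
  have "- A p \<subseteq> A q"
  proof
    fix xs assume "xs \<in> - A p"
    then have "\<bar>(\<Sum>i<n. ?h (xs ! i)) - real n * pmf p a\<bar> < t" by (simp add: A_def)
    moreover have "2 * t = \<bar>real n * pmf p a - real n * pmf q a\<bar>"
      by (simp add: t_def d_def abs_mult flip: right_diff_distrib)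
    ultimately show "xs \<in> A q" by (simp add: A_def)
  qed
  then have "measure_pmf.prob (iid_pmf n q) (- A p) \<le> measure_pmf.prob (iid_pmf n q) (A q)"
    by (intro measure_pmf.finite_measure_mono) auto
  moreover have "measure_pmf.prob (iid_pmf n q) (- A p) = 1 - measure_pmf.prob (iid_pmf n q) (A p)"
    using measure_pmf.prob_compl[of "A p" "iid_pmf n q"] by (simp add: Compl_eq_Diff_UNIV)
  ultimately have "1 - 2 * (real n / t\<^sup>2) \<le> tv_dist (iid_pmf n p) (iid_pmf n q)"
    using bd[of p] bd[of q] tv_dist_ge[of "iid_pmf n p" "A p" "iid_pmf n q"] by linarith
  then have "(1 - tv_dist (iid_pmf n p) (iid_pmf n q)) * (real n * (d a)\<^sup>2) \<le> 2 * (real n / t\<^sup>2) * (real n * (d a)\<^sup>2)"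
    by (intro mult_right_mono) auto
  also have "\<dots> = 8" using False by (simp add: t_def field_simps power2_eq_square)
  finally show ?thesis .
qed auto

subsection \<open>Approximation and coupling of distributions\<close>

lemma pmf_bind_finite:
  assumes "finite B" "set_pmf p \<subseteq> B"
  shows "pmf (bind_pmf p f) i = (\<Sum>x\<in>B. pmf p x * pmf (f x) i)"
  using assms by (subst pmf_bind, subst integral_measure_pmf_real[of B]) (auto simp: mult.commute)

lemma pmf_map_snd_finite:
  assumes "finite A" "set_pmf p \<subseteq> A \<times> UNIV"
  shows "pmf (map_pmf snd p) y = (\<Sum>x\<in>A. pmf p (x, y))"
proof -
  have "pmf (map_pmf snd p) y = measure_pmf.prob p (snd -` {y})" by (simp add: pmf_map)
  also have "\<dots> = measure_pmf.prob p (A \<times> {y})"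
    using assms(2) by (intro measure_pmf.finite_measure_eq_AE) (auto simp: AE_measure_pmf_iff)
  also have "\<dots> = (\<Sum>x\<in>A \<times> {y}. pmf p x)" using assms(1) by (intro measure_measure_pmf_finite) simp
  also have "\<dots> = (\<Sum>x\<in>A. pmf p (x, y))" 
    by (rule sum.reindex_bij_witness[of _ "\<lambda>x. (x, y)" fst]) auto
  finally show ?thesis .
qed

lemma ex_le_expectation:
  fixes h :: "'a \<Rightarrow> real"
  assumes "finite (set_pmf p)"
  shows "\<exists>x\<in>set_pmf p. h x \<le> measure_pmf.expectation p h"
proof (rule ccontr)
  define c where "c = measure_pmf.expectation p h"
  assume "\<not> ?thesis"
  then have *: "c < h x" if "x \<in> set_pmf p" for x using that by (force simp: c_def)
  have "c = (\<Sum>x\<in>set_pmf p. pmf p x * c)"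
    using assms by (simp add: sum_pmf_eq_1 flip: sum_distrib_right)
  also have "\<dots> < (\<Sum>x\<in>set_pmf p. pmf p x * h x)"
    using assms * by (intro sum_strict_mono) (auto simp: set_pmf_not_empty intro!: mult_strict_left_mono pmf_positive)
  also have "\<dots> = c" using assms by (simp add: c_def integral_measure_pmf[of "set_pmf p"])
  finally show False by simp
qed

lemma expectation_le_l1:
  fixes d :: "'a \<Rightarrow> real"
  assumes "finite B" "set_pmf p \<subseteq> B" "set_pmf q \<subseteq> B" "\<And>a. 0 \<le> d a \<and> d a \<le> c"
  shows "measure_pmf.expectation p d \<le> measure_pmf.expectation q d + c * (\<Sum>a\<in>B. \<bar>pmf p a - pmf q a\<bar>)"
proof -
  have "measure_pmf.expectation p d = (\<Sum>a\<in>B. d a * pmf p a)"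
    "measure_pmf.expectation q d = (\<Sum>a\<in>B. d a * pmf q a)"
    using assms by (auto intro!: integral_measure_pmf_real)
  moreover have "(\<Sum>a\<in>B. d a * pmf p a) \<le> (\<Sum>a\<in>B. d a * pmf q a + c * \<bar>pmf p a - pmf q a\<bar>)"
  proof (rule sum_mono)
    fix a
    have "d a * (pmf p a - pmf q a) \<le> d a * \<bar>pmf p a - pmf q a\<bar>"
      using assms(4)[of a] by (intro mult_left_mono) auto
    also have "\<dots> \<le> c * \<bar>pmf p a - pmf q a\<bar>" using assms(4)[of a] by (intro mult_right_mono) auto
    finally show "d a * pmf p a \<le> d a * pmf q a + c * \<bar>pmf p a - pmf q a\<bar>" by (simp add: algebra_simps)
  qed
  ultimately show ?thesis by (simp add: sum.distrib sum_distrib_left)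
qed

text \<open>Both masses sum to 1 over \<open>B\<close>, so excess and deficit balance. Rejection
  sampling bounds its output law only from below; this turns the one-sided estimate into a
  distance.\<close>

lemma l1_eq_pos_part:
  assumes "finite B" "set_pmf p \<subseteq> B" "set_pmf q \<subseteq> B"
  shows "(\<Sum>a\<in>B. \<bar>pmf p a - pmf q a\<bar>) = 2 * (\<Sum>a\<in>B. max 0 (pmf q a - pmf p a))"
proof -
  have "(\<Sum>a\<in>B. \<bar>pmf p a - pmf q a\<bar>) = (\<Sum>a\<in>B. 2 * max 0 (pmf q a - pmf p a) + pmf p a - pmf q a)"
    by (intro sum.cong) (auto simp: max_def)
  also have "\<dots> = 2 * (\<Sum>a\<in>B. max 0 (pmf q a - pmf p a))"
    using assms by (simp add: sum.distrib sum_subtractf sum_pmf_eq_1 flip: sum_distrib_left)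
  finally show ?thesis .
qed

text \<open>Maurey's empirical method, derandomised greedily: since the deviations have mean zero,
  some next seed increases the squared norm of their running sum by at most one.\<close>

lemma uniform_mixture_approx:
  fixes p :: "'s \<Rightarrow> 'a pmf"
  assumes fS: "finite (set_pmf S)" and fB: "finite B"
    and sub: "\<And>s. s \<in> set_pmf S \<Longrightarrow> set_pmf (p s) \<subseteq> B" and N: "0 < (N::nat)"
  shows "\<exists>\<sigma>::nat \<Rightarrow> 's. (\<forall>k. \<sigma> k \<in> set_pmf S) \<and>
    (\<Sum>a\<in>B. \<bar>(\<Sum>k=1..N. pmf (p (\<sigma> k)) a) / N - pmf (bind_pmf S p) a\<bar>) \<le> sqrt (card B / N)"
proof -
  define m where "m a = pmf (bind_pmf S p) a" for a
  define u where "u s a = pmf (p s) a - m a" for s a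
  have m: "m a = measure_pmf.expectation S (\<lambda>s. pmf (p s) a)" for a
    by (simp add: m_def pmf_bind)
  have intg: "integrable (measure_pmf S) g" for g :: "'s \<Rightarrow> real"
    by (rule integrable_measure_pmf_finite[OF fS])
  have u0: "measure_pmf.expectation S (\<lambda>s. u s a) = 0" for a
    by (simp add: u_def m intg)
  \<comment> \<open>The squared norm of a pmf is at most its sum, which is 1, and centring at the
    mean only lowers the second moment.\<close>
  have u1: "measure_pmf.expectation S (\<lambda>s. \<Sum>a\<in>B. (u s a)\<^sup>2) \<le> 1"
  proof -
    have "measure_pmf.expectation S (\<lambda>s. \<Sum>a\<in>B. (u s a)\<^sup>2)
        \<le> measure_pmf.expectation S (\<lambda>s. \<Sum>a\<in>B. pmf (p s) a - 2 * m a * pmf (p s) a + (m a)\<^sup>2)"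
    proof (intro expectation_mono_finite[OF fS] sum_mono)
      fix s a
      have "(pmf (p s) a)\<^sup>2 \<le> pmf (p s) a"
        using pmf_le_1[of "p s" a] pmf_nonneg[of "p s" a] by (simp add: power2_eq_square mult_left_le)
      then show "(u s a)\<^sup>2 \<le> pmf (p s) a - 2 * m a * pmf (p s) a + (m a)\<^sup>2"
        by (simp add: u_def power2_diff algebra_simps)
    qed
    also have "\<dots> = (\<Sum>a\<in>B. m a - 2 * m a * m a + (m a)\<^sup>2)"
      by (simp add: intg Bochner_Integration.integral_sum m)
    also have "\<dots> \<le> (\<Sum>a\<in>B. m a)"
      by (intro sum_mono) (simp add: power2_eq_square algebra_simps)
    also have "\<dots> = 1"
      unfolding m_def using sub fB by (intro sum_pmf_eq_1) auto
    finally show ?thesis .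
  qed
  have "\<exists>\<sigma>::nat \<Rightarrow> 's. (\<forall>k. \<sigma> k \<in> set_pmf S) \<and> (\<Sum>a\<in>B. (\<Sum>k=1..n. u (\<sigma> k) a)\<^sup>2) \<le> real n" for n
  proof (induction n)
    case 0
    obtain s where "s \<in> set_pmf S" using set_pmf_not_empty[of S] by blast
    then show ?case by (intro exI[of _ "\<lambda>_. s"]) simp
  next
    case (Suc n)
    then obtain \<sigma> where \<sigma>: "\<forall>k. \<sigma> k \<in> set_pmf S" and le: "(\<Sum>a\<in>B. (\<Sum>k=1..n. u (\<sigma> k) a)\<^sup>2) \<le> real n" by blast
    define v where "v a = (\<Sum>k=1..n. u (\<sigma> k) a)" for a
    obtain s where s: "s \<in> set_pmf S"
      and s_le: "(\<Sum>a\<in>B. (v a + u s a)\<^sup>2) \<le> measure_pmf.expectation S (\<lambda>s. \<Sum>a\<in>B. (v a + u s a)\<^sup>2)"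
      using ex_le_expectation[OF fS, of "\<lambda>s. \<Sum>a\<in>B. (v a + u s a)\<^sup>2"] by blast
    have "measure_pmf.expectation S (\<lambda>s. \<Sum>a\<in>B. (v a + u s a)\<^sup>2)
       = measure_pmf.expectation S (\<lambda>s. (\<Sum>a\<in>B. (v a)\<^sup>2) + ((\<Sum>a\<in>B. 2 * v a * u s a) + (\<Sum>a\<in>B. (u s a)\<^sup>2)))"
      by (intro arg_cong[where f = "measure_pmf.expectation S"] ext) (simp add: power2_sum sum.distrib)
    also have "\<dots> = (\<Sum>a\<in>B. (v a)\<^sup>2) + ((\<Sum>a\<in>B. 2 * v a * measure_pmf.expectation S (\<lambda>s. u s a))
        + measure_pmf.expectation S (\<lambda>s. \<Sum>a\<in>B. (u s a)\<^sup>2))"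
      by (simp add: expectation_add_finite[OF fS] Bochner_Integration.integral_sum intg)
    also have "\<dots> \<le> real n + 1" using le u1 by (simp add: u0 v_def)
    finally have "(\<Sum>a\<in>B. (v a + u s a)\<^sup>2) \<le> real (Suc n)" using s_le by simp
    moreover have "(\<Sum>k=1..Suc n. u ((\<sigma>(Suc n := s)) k) a) = v a + u s a" for a
      by (simp add: v_def)
    ultimately show ?case using \<sigma> s by (intro exI[of _ "\<sigma>(Suc n := s)"]) simp
  qed
  from this[of N] obtain \<sigma> where \<sigma>: "\<forall>k. \<sigma> k \<in> set_pmf S"
    and le: "(\<Sum>a\<in>B. (\<Sum>k=1..N. u (\<sigma> k) a)\<^sup>2) \<le> real N" by blast
  let ?e = "\<lambda>a. (\<Sum>k=1..N. pmf (p (\<sigma> k)) a) / N - pmf (bind_pmf S p) a"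
  have e: "?e a = (\<Sum>k=1..N. u (\<sigma> k) a) / N" for a
    using N by (simp add: u_def sum_subtractf m_def field_simps)
  \<comment> \<open>Cauchy-Schwarz passes from the squared norm to the L1 norm at the price of the
    factor \<open>card B\<close>, which \<open>N\<close> has to outgrow.\<close>
  have "(\<Sum>a\<in>B. \<bar>?e a\<bar> * 1)\<^sup>2 \<le> (\<Sum>a\<in>B. \<bar>?e a\<bar>\<^sup>2) * (\<Sum>a\<in>B. 1\<^sup>2)"
    by (rule Cauchy_Schwarz_ineq_sum)
  also have "(\<Sum>a\<in>B. \<bar>?e a\<bar>\<^sup>2) = (\<Sum>a\<in>B. (\<Sum>k=1..N. u (\<sigma> k) a)\<^sup>2) / (real N)\<^sup>2"
    unfolding e by (simp add: power_divide flip: sum_divide_distrib)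
  also have "\<dots> * (\<Sum>a\<in>B. 1\<^sup>2) \<le> real N / (real N)\<^sup>2 * (\<Sum>a\<in>B. 1\<^sup>2)"
    using le by (intro mult_right_mono divide_right_mono) auto
  also have "\<dots> = card B / N" using N by (simp add: power2_eq_square)
  finally have "(\<Sum>a\<in>B. \<bar>?e a\<bar>) \<le> sqrt (card B / N)" by (intro real_le_rsqrt) simp
  with \<sigma> show ?thesis by blast
qed

lemma pmf_bernoulli_mix:
  assumes "0 \<le> c" "c \<le> 1"
  shows "pmf (bind_pmf (bernoulli_pmf c) (\<lambda>b. if b then p else q)) y = c * pmf p y + (1 - c) * pmf q y"
  using assms by (simp add: pmf_bind)

text \<open>Maximal coupling in the form of a kernel: \<open>y\<close> is kept with probability
  \<open>min 1 (pmf q y / pmf p y)\<close> and otherwise redrawn from the normalised excess of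
  \<open>q\<close> over \<open>p\<close>. The kernel reads nothing but \<open>y\<close>, so a
  decoder can apply it to its own output. The construction changes \<open>y\<close> with probability
  at most half the L1 distance; the stated bound is looser by a factor 2.\<close>

lemma coupling_kernel:
  fixes p q :: "'a pmf"
  assumes fB: "finite B" and pB: "set_pmf p \<subseteq> B" and qB: "set_pmf q \<subseteq> B"
  shows "\<exists>\<kappa>. bind_pmf p \<kappa> = q \<and> (\<forall>y\<in>B. set_pmf (\<kappa> y) \<subseteq> B) \<and>
    measure_pmf.expectation p (\<lambda>y. 1 - pmf (\<kappa> y) y) \<le> (\<Sum>y\<in>B. \<bar>pmf p y - pmf q y\<bar>)"
proof (cases "p = q")
  case True
  then show ?thesis by (intro exI[of _ return_pmf]) (simp add: bind_return_pmf')
next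
  case False
  \<comment> \<open>Total excess of \<open>q\<close> over \<open>p\<close>. It normalises the law
    \<open>r\<close> below and must not vanish, hence the separate case
    \<open>p = q\<close>.\<close>
  define \<delta> where "\<delta> = (\<Sum>y\<in>B. max 0 (pmf q y - pmf p y))"
  have "\<delta> \<noteq> 0"
  proof
    assume "\<delta> = 0"
    then have "(\<Sum>y\<in>B. \<bar>pmf p y - pmf q y\<bar>) = 0"
      using l1_eq_pos_part[OF fB pB qB] by (simp add: \<delta>_def)
    then have "\<forall>y\<in>B. pmf p y = pmf q y" using fB by (simp add: sum_nonneg_eq_0_iff)
    moreover have "pmf p y = pmf q y" if "y \<notin> B" for y
      using that pB qB by (metis in_mono pmf_eq_0_set_pmf)
    ultimately have "p = q" by (intro pmf_eqI) blast
    then show False using False by simp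
  qed
  moreover have "0 \<le> \<delta>" unfolding \<delta>_def by (intro sum_nonneg) simp
  ultimately have \<delta>: "0 < \<delta>" by simp
  define \<rho> where "\<rho> y = (if y \<in> B then max 0 (pmf q y - pmf p y) / \<delta> else 0)" for y
  define r where "r = embed_pmf \<rho>"
  have r: "pmf r y = \<rho> y" for y
    unfolding r_def
  proof (rule pmf_embed_pmf)
    show "0 \<le> \<rho> x" for x using \<delta> by (simp add: \<rho>_def)
    have "(\<integral>\<^sup>+x. ennreal (\<rho> x) \<partial>count_space UNIV) = (\<integral>\<^sup>+x. ennreal (\<rho> x) \<partial>count_space B)"
      by (subst nn_integral_count_space_indicator) (auto simp: \<rho>_def intro!: nn_integral_cong)
    also have "\<dots> = ennreal (\<Sum>x\<in>B. \<rho> x)"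
      using fB \<delta> by (simp add: nn_integral_count_space_finite \<rho>_def)
    also have "(\<Sum>x\<in>B. \<rho> x) = 1"
      using \<delta> by (simp add: \<rho>_def \<delta>_def flip: sum_divide_distrib)
    finally show "(\<integral>\<^sup>+x. ennreal (\<rho> x) \<partial>count_space UNIV) = 1" by simp
  qed
  define c where "c y = min 1 (pmf q y / pmf p y)" for y
  have c01: "0 \<le> c y" "c y \<le> 1" for y by (auto simp: c_def)
  have pc: "pmf p y * c y = min (pmf p y) (pmf q y)" for y
  proof (cases "pmf p y = 0")
    case False
    then have "0 < pmf p y" by (simp add: pmf_pos)
    then show ?thesis by (auto simp: c_def min_def field_simps)
  qed simp
  define \<kappa> where "\<kappa> y = bind_pmf (bernoulli_pmf (c y)) (\<lambda>b. if b then return_pmf y else r)" for y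
  have \<kappa>: "pmf (\<kappa> y) y' = c y * indicator {y} y' + (1 - c y) * \<rho> y'" for y y'
    unfolding \<kappa>_def by (subst pmf_bernoulli_mix) (use c01 in \<open>auto simp: r indicator_def\<close>)
  have min1: "(\<Sum>y\<in>B. min (pmf p y) (pmf q y)) = 1 - \<delta>"
  proof -
    have "(\<Sum>y\<in>B. min (pmf p y) (pmf q y)) = (\<Sum>y\<in>B. pmf q y - max 0 (pmf q y - pmf p y))"
      by (intro sum.cong) auto
    then show ?thesis using fB qB by (simp add: sum_subtractf sum_pmf_eq_1 \<delta>_def)
  qed
  \<comment> \<open>The mass given up by \<open>p\<close> equals the total excess of
    \<open>q\<close>, so redrawing from \<open>r\<close> refills exactly what is missing.\<close>
  have mass: "(\<Sum>y\<in>B. pmf p y * (1 - c y)) = \<delta>"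
    using min1 fB pB by (simp add: right_diff_distrib sum_subtractf pc sum_pmf_eq_1)
  have "bind_pmf p \<kappa> = q"
  proof (rule pmf_eqI)
    fix y'
    have "pmf (bind_pmf p \<kappa>) y' = (\<Sum>y\<in>B. pmf p y * c y * indicator {y} y' + pmf p y * (1 - c y) * \<rho> y')"
      by (subst pmf_bind_finite[OF fB pB]) (simp add: \<kappa> algebra_simps)
    also have "\<dots> = (\<Sum>y\<in>B. if y = y' then pmf p y * c y else 0) + \<delta> * \<rho> y'"
      by (simp add: sum.distrib mass flip: sum_distrib_right) (auto intro!: sum.cong simp: indicator_def)
    also have "\<dots> = pmf q y'"
    proof (cases "y' \<in> B")
      case True
      then show ?thesis using \<delta> fB by (simp add: pc \<rho>_def)
    next
      case False
      then have "pmf q y' = 0" using qB by (auto simp: set_pmf_iff)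
      with False fB show ?thesis by (simp add: \<rho>_def)
    qed
    finally show "pmf (bind_pmf p \<kappa>) y' = pmf q y'" .
  qed
  moreover have "set_pmf (\<kappa> y) \<subseteq> B" if "y \<in> B" for y
    using that by (auto simp: set_pmf_iff \<kappa> \<rho>_def indicator_def split: if_splits)
  moreover have "measure_pmf.expectation p (\<lambda>y. 1 - pmf (\<kappa> y) y) \<le> (\<Sum>y\<in>B. \<bar>pmf p y - pmf q y\<bar>)"
  proof -
    have "measure_pmf.expectation p (\<lambda>y. 1 - pmf (\<kappa> y) y) \<le> measure_pmf.expectation p (\<lambda>y. 1 - c y)"
    proof (rule expectation_mono_finite)
      show "finite (set_pmf p)" using fB pB by (rule finite_subset[rotated])
      fix y
      have "0 \<le> (1 - c y) * \<rho> y" using c01[of y] \<delta> by (intro mult_nonneg_nonneg) (auto simp: \<rho>_def)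
      then show "1 - pmf (\<kappa> y) y \<le> 1 - c y" by (simp add: \<kappa>)
    qed
    also have "\<dots> = (\<Sum>y\<in>B. (1 - c y) * pmf p y)"
      using fB pB by (intro integral_measure_pmf_real) auto
    also have "\<dots> = \<delta>" using mass by (simp add: mult.commute)
    also have "\<dots> \<le> (\<Sum>y\<in>B. \<bar>pmf p y - pmf q y\<bar>)"
      unfolding \<delta>_def by (intro sum_mono) auto
    finally show ?thesis .
  qed
  ultimately show ?thesis by blast
qed

text \<open>The index returned is that of the first accepted entry; \<open>length ys\<close> signals that every entry
  was rejected, and \<open>rej_out\<close> then outputs the default \<open>b\<close>.\<close>

primrec rej_enc :: "('b \<Rightarrow> real) \<Rightarrow> 'b list \<Rightarrow> nat pmf" where
  "rej_enc acc [] = return_pmf 0"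
| "rej_enc acc (y # ys) =
     bind_pmf (bernoulli_pmf (acc y)) (\<lambda>b. if b then return_pmf 0 else map_pmf Suc (rej_enc acc ys))"

lemma rej_enc_le_length: "i \<in> set_pmf (rej_enc acc ys) \<Longrightarrow> i \<le> length ys"
proof (induction ys arbitrary: i)
  case (Cons y ys)
  then obtain b where b: "i \<in> set_pmf (if b then return_pmf 0 else map_pmf Suc (rej_enc acc ys))"
    by (auto simp: set_bind_pmf)
  then show ?case using Cons.IH by (cases b) auto
qed simp

definition rej_out :: "('b \<Rightarrow> real) \<Rightarrow> 'b \<Rightarrow> nat \<Rightarrow> 'b pmf \<Rightarrow> 'b pmf" where
  "rej_out acc b L q = bind_pmf (iid_pmf L q) (\<lambda>s. map_pmf (\<lambda>i. (s @ [b]) ! i) (rej_enc acc s))"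

text \<open>One round of the sampler: the rest of the list is independent of the first codeword and
  of its coin, so a rejection restarts with a fresh list that is one shorter.\<close>

lemma rej_out_Suc:
  "rej_out acc b (Suc L) q =
     bind_pmf q (\<lambda>y. bind_pmf (bernoulli_pmf (acc y)) (\<lambda>t. if t then return_pmf y else rej_out acc b L q))"
proof -
  have "rej_out acc b (Suc L) q = bind_pmf q (\<lambda>y. bind_pmf (iid_pmf L q) (\<lambda>s.
      bind_pmf (bernoulli_pmf (acc y)) (\<lambda>t. if t then return_pmf y
        else map_pmf (\<lambda>i. (s @ [b]) ! i) (rej_enc acc s))))"
    by (simp add: rej_out_def bind_assoc_pmf bind_map_pmf map_bind_pmf if_distrib[of "map_pmf _"] map_pmf_comp cong: if_cong)
  also have "\<dots> = bind_pmf q (\<lambda>y. bind_pmf (bernoulli_pmf (acc y)) (\<lambda>t. bind_pmf (iid_pmf L q) (\<lambda>s.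
      if t then return_pmf y else map_pmf (\<lambda>i. (s @ [b]) ! i) (rej_enc acc s))))"
    by (subst bind_commute_pmf) (rule refl)
  also have "\<dots> = bind_pmf q (\<lambda>y. bind_pmf (bernoulli_pmf (acc y)) (\<lambda>t. if t then return_pmf y else rej_out acc b L q))"
    by (intro bind_pmf_cong refl) (simp add: rej_out_def)
  finally show ?thesis .
qed

lemma pmf_rej_out_Suc:
  assumes fin: "finite (set_pmf q)" and acc: "\<And>y. 0 \<le> acc y \<and> acc y \<le> 1"
  shows "pmf (rej_out acc b (Suc L) q) y
    = pmf q y * acc y + (1 - measure_pmf.expectation q acc) * pmf (rej_out acc b L q) y"
proof -
  let ?o = "pmf (rej_out acc b L q) y"
  have intg: "integrable (measure_pmf q) g" for g :: "'a \<Rightarrow> real"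
    by (rule integrable_measure_pmf_finite[OF fin])
  have "pmf (rej_out acc b (Suc L) q) y
     = measure_pmf.expectation q (\<lambda>y'. acc y' * indicator {y'} y + (1 - acc y') * ?o)"
    unfolding rej_out_Suc pmf_bind[of q]
    by (intro arg_cong[where f = "measure_pmf.expectation q"] ext, subst pmf_bernoulli_mix)
       (use acc in \<open>auto simp: indicator_def\<close>)
  also have "\<dots> = measure_pmf.expectation q (\<lambda>y'. acc y' * indicator {y'} y)
      + measure_pmf.expectation q (\<lambda>y'. (1 - acc y') * ?o)"
    by (rule expectation_add_finite[OF fin])
  also have "measure_pmf.expectation q (\<lambda>y'. acc y' * indicator {y'} y) = acc y * pmf q y"
    by (subst integral_measure_pmf_real[of "{y}"]) (auto simp: indicator_def split: if_splits)
  also have "measure_pmf.expectation q (\<lambda>y'. (1 - acc y') * ?o) = (1 - measure_pmf.expectation q acc) * ?o"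
    by (simp add: intg)
  finally show ?thesis by simp
qed

text \<open>\<open>u * (1 - u) ^ L\<close> is the smallest of \<open>L + 1\<close> geometric terms
  whose sum is at most 1. It yields the error \<open>T / (L + 1)\<close> for an exhausted list
  without exponential estimates.\<close>

lemma geometric_tail_bound:
  fixes u :: real
  assumes "0 \<le> u" "u \<le> 1"
  shows "real (Suc L) * (u * (1 - u) ^ L) \<le> 1"
proof -
  have "real (Suc L) * (u * (1 - u) ^ L) = (\<Sum>j<Suc L. u * (1 - u) ^ L)" by simp
  also have "\<dots> \<le> (\<Sum>j<Suc L. u * (1 - u) ^ j)"
    using assms by (intro sum_mono mult_left_mono power_decreasing) auto
  also have "\<dots> = u * (\<Sum>j<Suc L. (1 - u) ^ j)" by (simp only: sum_distrib_left)
  also have "\<dots> = 1 - (1 - u) ^ Suc L"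
    using one_diff_power_eq[of "1 - u" "Suc L"] by simp
  also have "\<dots> \<le> 1" using assms by simp
  finally show ?thesis .
qed

text \<open>Accepted proposals follow the truncated mass \<open>c = min w (T * q)\<close>. What is
  missing from \<open>w\<close> is the truncated part, carried by the points of likelihood ratio
  above \<open>T\<close>, and the event that all \<open>L\<close> proposals are rejected.\<close>

lemma rejection_sampling_error:
  fixes w q :: "'b pmf" and T :: real
  assumes fB: "finite B" and wB: "set_pmf w \<subseteq> B" and qB: "set_pmf q \<subseteq> B" and T: "0 < T"
  defines "acc \<equiv> \<lambda>y. min 1 (pmf w y / (T * pmf q y))"
  shows "(\<Sum>y\<in>B. max 0 (pmf w y - pmf (rej_out acc b L q) y))
    \<le> measure_pmf.prob w {y. T * pmf q y < pmf w y} + T / Suc L"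
proof -
  have fin: "finite (set_pmf q)" using fB qB by (rule finite_subset[rotated])
  have acc01: "0 \<le> acc y \<and> acc y \<le> 1" for y using T by (simp add: acc_def)
  define c where "c y = min (pmf w y) (T * pmf q y)" for y
  have c0: "0 \<le> c y" for y using T by (simp add: c_def)
  have qacc: "pmf q y * acc y = c y / T" for y
  proof (cases "pmf q y = 0")
    case False
    then have "0 < pmf q y" by (simp add: pmf_pos)
    then show ?thesis using T by (auto simp: acc_def c_def min_def field_simps)
  qed (simp add: c_def)
  define \<alpha> where "\<alpha> = (\<Sum>y\<in>B. c y)"
  define a where "a = measure_pmf.expectation q acc"
  have a: "a = \<alpha> / T"
  proof -
    have "a = (\<Sum>y\<in>B. acc y * pmf q y)"
      unfolding a_def using fB qB by (intro integral_measure_pmf_real) auto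
    then show ?thesis by (simp add: \<alpha>_def sum_divide_distrib qacc mult.commute[of "acc _"])
  qed
  have \<alpha>1: "\<alpha> \<le> 1"
  proof -
    have "\<alpha> \<le> (\<Sum>y\<in>B. pmf w y)" unfolding \<alpha>_def by (intro sum_mono) (simp add: c_def)
    then show ?thesis using fB wB by (simp add: sum_pmf_eq_1)
  qed
  have \<alpha>0: "0 \<le> \<alpha>" unfolding \<alpha>_def by (intro sum_nonneg c0)
  have "a \<le> measure_pmf.expectation q (\<lambda>_. 1)"
    unfolding a_def using acc01 by (intro expectation_mono_finite[OF fin]) auto
  then have a01: "0 \<le> a" "a \<le> 1" using \<alpha>0 T by (auto simp: a)
  \<comment> \<open>Since \<open>\<alpha> \<le> 1\<close>, a round emits \<open>y\<close> with
    probability \<open>c y / T\<close>, at least \<open>a * c y\<close>; thus each round supplies a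
    fraction \<open>a\<close> of the \<open>c y\<close> still missing.\<close>
  have lower: "c y * (1 - (1 - a) ^ L) \<le> pmf (rej_out acc b L q) y" for y
  proof (induction L)
    case (Suc L)
    have "c y * a \<le> c y / T" using mult_right_mono[OF \<alpha>1 c0[of y]] T by (simp add: a field_simps)
    moreover have "(1 - a) * (c y * (1 - (1 - a) ^ L)) \<le> (1 - a) * pmf (rej_out acc b L q) y"
      using Suc a01 by (intro mult_left_mono) auto
    ultimately have "c y * a + (1 - a) * (c y * (1 - (1 - a) ^ L)) \<le> pmf (rej_out acc b (Suc L) q) y"
      by (simp add: pmf_rej_out_Suc[OF fin acc01] qacc a_def[symmetric])
    then show ?case by (simp add: algebra_simps)
  qed simp
  have "(\<Sum>y\<in>B. max 0 (pmf w y - pmf (rej_out acc b L q) y)) \<le> (\<Sum>y\<in>B. (pmf w y - c y) + c y * (1 - a) ^ L)"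
  proof (rule sum_mono)
    fix y
    have "c y \<le> pmf w y" by (simp add: c_def)
    moreover have "0 \<le> c y * (1 - a) ^ L" using c0[of y] a01 by simp
    ultimately show "max 0 (pmf w y - pmf (rej_out acc b L q) y) \<le> (pmf w y - c y) + c y * (1 - a) ^ L"
      using lower[of y] by (simp add: right_diff_distrib)
  qed
  also have "\<dots> = (\<Sum>y\<in>B. pmf w y - c y) + \<alpha> * (1 - a) ^ L"
    by (simp add: sum.distrib \<alpha>_def sum_distrib_right)
  also have "(\<Sum>y\<in>B. pmf w y - c y) \<le> (\<Sum>y\<in>B. indicator {y. T * pmf q y < pmf w y} y * pmf w y)"
  proof (rule sum_mono)
    fix y
    have "0 \<le> T * pmf q y" using T by simp
    then show "pmf w y - c y \<le> indicator {y. T * pmf q y < pmf w y} y * pmf w y"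
      by (auto simp: c_def indicator_def)
  qed
  also have "\<dots> = measure_pmf.expectation w (indicator {y. T * pmf q y < pmf w y})"
    using fB wB by (intro integral_measure_pmf_real[symmetric]) auto
  also have "\<alpha> * (1 - a) ^ L \<le> T / Suc L"
    using geometric_tail_bound[OF a01, of L] T by (simp add: a field_simps)
  finally show ?thesis by simp
qed

subsection \<open>One-shot channel simulation\<close>

text \<open>The law of \<open>(x, y)\<close> is moved from \<open>p\<close> to \<open>Lbar\<close>
  (random list), to \<open>Lhat\<close> (\<open>N\<close> fixed lists), and to \<open>J\<close>
  (after the coupling kernel). The first two moves cost at most \<open>\<delta>\<close> in L1
  distance together. The output law of \<open>Lhat\<close> is therefore within
  \<open>\<delta>\<close> of \<open>q\<close>, and the kernel costs at most a second
  \<open>\<delta>\<close>.\<close>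

lemma one_shot_simulation:
  fixes px :: "'a pmf" and w :: "'a \<Rightarrow> 'b pmf" and T :: real
  assumes fA: "finite A" and pxA: "set_pmf px \<subseteq> A" and fB: "finite B"
    and wB: "\<And>x. x \<in> set_pmf px \<Longrightarrow> set_pmf (w x) \<subseteq> B"
    and T: "0 < T" and M: "0 < (M::nat)" and N: "0 < (N::nat)"
  defines "q \<equiv> bind_pmf px w"
    and "p \<equiv> bind_pmf px (\<lambda>x. map_pmf (Pair x) (w x))"
  defines "\<delta> \<equiv> 2 * (measure_pmf.prob p {(x, y). T * pmf q y < pmf (w x) y} + T / M)
      + sqrt (card A * card B / N)"
  shows "\<exists>(f :: 'a \<Rightarrow> nat \<Rightarrow> nat pmf) (g :: nat \<Rightarrow> nat \<Rightarrow> 'b pmf).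
     (\<forall>x k. set_pmf (f x k) \<subseteq> {1..M}) \<and> (\<forall>m\<in>{1..M}. \<forall>k. set_pmf (g m k) \<subseteq> B) \<and>
     (let J = bind_pmf px (\<lambda>x. bind_pmf (pmf_of_set {1..N}) (\<lambda>k. bind_pmf (f x k) (\<lambda>m. map_pmf (Pair x) (g m k))))
      in map_pmf snd J = q \<and>
        (\<forall>d c. (\<forall>t. 0 \<le> d t \<and> d t \<le> c) \<longrightarrow>
           measure_pmf.expectation J d \<le> measure_pmf.expectation p d + c * (2 * \<delta>)))"
proof -
  have fpx: "finite (set_pmf px)" using fA pxA by (rule finite_subset[rotated])
  have qB: "set_pmf q \<subseteq> B" using wB by (auto simp: q_def)
  have fq: "finite (set_pmf q)" using fB qB by (rule finite_subset[rotated])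
  obtain b where b: "b \<in> B" using qB set_pmf_not_empty[of q] by blast
  \<comment> \<open>The last message \<open>M\<close> stands for the default \<open>b\<close>, used
    when all \<open>M - 1\<close> codewords are rejected.\<close>
  define L where "L = M - 1"
  have L: "Suc L = M" using M by (simp add: L_def)
  define acc where "acc x = (\<lambda>y. min 1 (pmf (w x) y / (T * pmf q y)))" for x
  define S where "S = iid_pmf L q"
  define dec where "dec s i = (s @ [b]) ! i" for s i
  define Ls where "Ls s = bind_pmf px (\<lambda>x. map_pmf (Pair x) (map_pmf (dec s) (rej_enc (acc x) s)))" for s
  have fS: "finite (set_pmf S)" unfolding S_def by (rule finite_set_iid_pmf[OF fq])
  have SB: "length s = L" "set s \<subseteq> B" if "s \<in> set_pmf S" for s
    using length_iid_pmf[of s L q] set_iid_pmf[of s L q] that qB by (auto simp: S_def)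
  have dec: "dec s i \<in> B" if "s \<in> set_pmf S" "i \<le> L" for s i
    using SB[OF that(1)] that(2) b nth_mem[of i s] by (cases "i = L") (auto simp: dec_def nth_append)
  have decenc: "set_pmf (map_pmf (dec s) (rej_enc a s)) \<subseteq> B" if "s \<in> set_pmf S" for s a
    using dec[OF that] SB(1)[OF that] by (auto dest!: rej_enc_le_length)
  have LsAB: "set_pmf (Ls s) \<subseteq> A \<times> B" if "s \<in> set_pmf S" for s
    using decenc[OF that] pxA by (fastforce simp: Ls_def)
  define Lbar where "Lbar = bind_pmf S Ls"
  have Lbar: "Lbar = bind_pmf px (\<lambda>x. map_pmf (Pair x) (rej_out (acc x) b L q))"
    unfolding Lbar_def Ls_def rej_out_def S_def[symmetric]
    by (subst bind_commute_pmf) (simp add: map_bind_pmf dec_def[abs_def])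
  have LbarAB: "set_pmf Lbar \<subseteq> A \<times> B" using LsAB by (auto simp: Lbar_def)
  have pAB: "set_pmf p \<subseteq> A \<times> B" using pxA wB by (fastforce simp: p_def)
  have fAB: "finite (A \<times> B)" using fA fB by simp
  have d1: "(\<Sum>a\<in>A\<times>B. \<bar>pmf Lbar a - pmf p a\<bar>)
      \<le> 2 * (measure_pmf.prob p {(x, y). T * pmf q y < pmf (w x) y} + T / M)"
  proof -
    have "(\<Sum>a\<in>A\<times>B. max 0 (pmf p a - pmf Lbar a))
       = (\<Sum>x\<in>A. pmf px x * (\<Sum>y\<in>B. max 0 (pmf (w x) y - pmf (rej_out (acc x) b L q) y)))"
    proof -
      have "max 0 (pmf p (x, y) - pmf Lbar (x, y)) = pmf px x * max 0 (pmf (w x) y - pmf (rej_out (acc x) b L q) y)" for x y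
        unfolding p_def Lbar pmf_bind_map_Pair
        by (simp add: max_mult_distrib_left right_diff_distrib)
      then show ?thesis by (simp add: sum.cartesian_product' sum_distrib_left)
    qed
    also have "\<dots> \<le> (\<Sum>x\<in>A. pmf px x * (measure_pmf.prob (w x) {y. T * pmf q y < pmf (w x) y} + T / M))"
    proof (rule sum_mono)
      fix x
      show "pmf px x * (\<Sum>y\<in>B. max 0 (pmf (w x) y - pmf (rej_out (acc x) b L q) y))
        \<le> pmf px x * (measure_pmf.prob (w x) {y. T * pmf q y < pmf (w x) y} + T / M)"
      proof (cases "x \<in> set_pmf px")
        case True
        then show ?thesis
          using rejection_sampling_error[OF fB wB[OF True] qB T, of b L]
          by (intro mult_left_mono) (auto simp: acc_def L)
      qed (simp add: set_pmf_iff)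
    qed
    also have "\<dots> = measure_pmf.expectation px (\<lambda>x. measure_pmf.prob (w x) {y. T * pmf q y < pmf (w x) y} + T / M)"
      using fA pxA by (subst integral_measure_pmf_real[of A]) (auto simp: mult.commute)
    also have "\<dots> = measure_pmf.expectation px (\<lambda>x. measure_pmf.prob (w x) {y. T * pmf q y < pmf (w x) y}) + T / M"
      by (simp add: expectation_add_finite[OF fpx])
    also have "measure_pmf.expectation px (\<lambda>x. measure_pmf.prob (w x) {y. T * pmf q y < pmf (w x) y})
       = measure_pmf.expectation p (indicator {(x, y). T * pmf q y < pmf (w x) y})"
    proof -
      have "measure_pmf.expectation p (indicator {(x, y). T * pmf q y < pmf (w x) y} :: _ \<Rightarrow> real)
        = measure_pmf.expectation px (\<lambda>x. measure_pmf.expectation (map_pmf (Pair x) (w x)) (indicator {(x, y). T * pmf q y < pmf (w x) y}))"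
        unfolding p_def using fpx wB fB by (intro expectation_bind_finite) (auto intro: finite_subset)
      also have "\<dots> = measure_pmf.expectation px (\<lambda>x. measure_pmf.expectation (w x) (indicator {y. T * pmf q y < pmf (w x) y}))"
        by (simp add: indicator_def[abs_def])
      finally show ?thesis by simp
    qed
    finally show ?thesis using l1_eq_pos_part[OF fAB LbarAB pAB] by simp
  qed
  \<comment> \<open>A seed is a whole list, and each key value is assigned one. The approximation
    runs over \<open>A \<times> B\<close> because distortion depends on the joint law of input and
    output, not just on the output law.\<close>
  obtain \<sigma> where \<sigma>: "\<And>k. \<sigma> k \<in> set_pmf S"
    and d2: "(\<Sum>a\<in>A\<times>B. \<bar>(\<Sum>k=1..N. pmf (Ls (\<sigma> k)) a) / N - pmf Lbar a\<bar>) \<le> sqrt (card (A \<times> B) / N)"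
    using uniform_mixture_approx[of S "A \<times> B" Ls N, OF fS fAB LsAB N] unfolding Lbar_def by blast
  define Lhat where "Lhat = bind_pmf (pmf_of_set {1..N}) (\<lambda>k. Ls (\<sigma> k))"
  have ne: "{1..N} \<noteq> {}" using N by simp
  have pmf_Lhat: "pmf Lhat a = (\<Sum>k=1..N. pmf (Ls (\<sigma> k)) a) / N" for a
    unfolding Lhat_def by (subst pmf_bind_pmf_of_set[OF ne]) auto
  have LhatAB: "set_pmf Lhat \<subseteq> A \<times> B" using LsAB[OF \<sigma>] by (auto simp: Lhat_def)
  have d: "(\<Sum>a\<in>A\<times>B. \<bar>pmf Lhat a - pmf p a\<bar>) \<le> \<delta>"
  proof -
    have "(\<Sum>a\<in>A\<times>B. \<bar>pmf Lhat a - pmf p a\<bar>) \<le> (\<Sum>a\<in>A\<times>B. \<bar>pmf Lhat a - pmf Lbar a\<bar> + \<bar>pmf Lbar a - pmf p a\<bar>)"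
      by (intro sum_mono) linarith
    then show ?thesis using d1 d2 by (simp add: sum.distrib \<delta>_def pmf_Lhat card_cartesian_product)
  qed
  define qh where "qh = map_pmf snd Lhat"
  have qhB: "set_pmf qh \<subseteq> B" using LhatAB by (auto simp: qh_def)
  have q_snd: "map_pmf snd p = q"
    by (simp add: p_def q_def map_bind_pmf map_pmf_comp)
  have dq: "(\<Sum>y\<in>B. \<bar>pmf qh y - pmf q y\<bar>) \<le> \<delta>"
  proof -
    have "(\<Sum>y\<in>B. \<bar>pmf qh y - pmf q y\<bar>) = (\<Sum>y\<in>B. \<bar>\<Sum>x\<in>A. pmf Lhat (x, y) - pmf p (x, y)\<bar>)"
      unfolding qh_def q_snd[symmetric] using LhatAB pAB fA
      by (subst (1 2) pmf_map_snd_finite[of A]) (auto simp: sum_subtractf)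
    also have "\<dots> \<le> (\<Sum>y\<in>B. \<Sum>x\<in>A. \<bar>pmf Lhat (x, y) - pmf p (x, y)\<bar>)"
      by (intro sum_mono sum_abs)
    also have "\<dots> = (\<Sum>a\<in>A\<times>B. \<bar>pmf Lhat a - pmf p a\<bar>)"
      by (subst sum.swap) (simp add: sum.cartesian_product')
    finally show ?thesis using d by simp
  qed
  obtain \<kappa> where \<kappa>: "bind_pmf qh \<kappa> = q" and \<kappa>B: "\<And>y. y \<in> B \<Longrightarrow> set_pmf (\<kappa> y) \<subseteq> B"
    and \<kappa>d: "measure_pmf.expectation qh (\<lambda>y. 1 - pmf (\<kappa> y) y) \<le> (\<Sum>y\<in>B. \<bar>pmf qh y - pmf q y\<bar>)"
    using coupling_kernel[OF fB qhB qB] by blast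
  define f where "f x k = map_pmf Suc (rej_enc (acc x) (\<sigma> k))" for x k
  define g where "g m k = \<kappa> (dec (\<sigma> k) (m - 1))" for m k
  define J where "J = bind_pmf px (\<lambda>x. bind_pmf (pmf_of_set {1..N}) (\<lambda>k. bind_pmf (f x k) (\<lambda>m. map_pmf (Pair x) (g m k))))"
  have J: "J = bind_pmf Lhat (\<lambda>(x, y). map_pmf (Pair x) (\<kappa> y))"
    unfolding J_def Lhat_def Ls_def f_def g_def
    by (subst bind_commute_pmf) (simp add: bind_assoc_pmf bind_map_pmf)
  have "set_pmf (f x k) \<subseteq> {1..M}" for x k
    using SB(1)[OF \<sigma>[of k]] L by (auto simp: f_def dest!: rej_enc_le_length)
  moreover have "set_pmf (g m k) \<subseteq> B" if "m \<in> {1..M}" for m k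
    unfolding g_def using that L by (intro \<kappa>B dec \<sigma>) auto
  moreover have "map_pmf snd J = q"
    unfolding J \<kappa>[symmetric] qh_def
    by (simp add: map_bind_pmf bind_map_pmf map_pmf_comp case_prod_unfold)
  moreover have "measure_pmf.expectation J h \<le> measure_pmf.expectation p h + c * (2 * \<delta>)"
    if h: "\<forall>t. 0 \<le> h t \<and> h t \<le> c" for h c
  proof -
    have c: "0 \<le> c" using h by (meson order_trans)
    have fLh: "finite (set_pmf Lhat)" using fAB LhatAB by (rule finite_subset[rotated])
    have f\<kappa>: "finite (set_pmf (\<kappa> y))" if "y \<in> B" for y using \<kappa>B[OF that] fB by (rule finite_subset)
    have "measure_pmf.expectation J h = measure_pmf.expectation Lhat (\<lambda>t. measure_pmf.expectation (\<kappa> (snd t)) (\<lambda>y'. h (fst t, y')))"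
      unfolding J using fLh f\<kappa> LhatAB by (subst expectation_bind_finite) (auto simp: case_prod_unfold)
    also have "\<dots> \<le> measure_pmf.expectation Lhat (\<lambda>t. h t + c * (1 - pmf (\<kappa> (snd t)) (snd t)))"
    proof (rule expectation_mono_finite[OF fLh])
      fix t assume "t \<in> set_pmf Lhat"
      then have y: "snd t \<in> B" using LhatAB by auto
      let ?y = "snd t"
      have "measure_pmf.expectation (\<kappa> ?y) (\<lambda>y'. h (fst t, y'))
         \<le> measure_pmf.expectation (\<kappa> ?y) (\<lambda>y'. h t + c * (1 - indicator {?y} y'))"
        using h by (intro expectation_mono_finite[OF f\<kappa>[OF y]]) (cases t, auto simp: indicator_def intro: add_increasing)
      also have "\<dots> = h t + c * (1 - pmf (\<kappa> ?y) ?y)"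
        using f\<kappa>[OF y] by (simp add: integrable_measure_pmf_finite pmf.rep_eq)
      finally show "measure_pmf.expectation (\<kappa> ?y) (\<lambda>y'. h (fst t, y')) \<le> h t + c * (1 - pmf (\<kappa> ?y) ?y)" .
    qed
    also have "\<dots> = measure_pmf.expectation Lhat h + c * measure_pmf.expectation qh (\<lambda>y. 1 - pmf (\<kappa> y) y)"
      by (simp add: expectation_add_finite[OF fLh] qh_def)
    also have "\<dots> \<le> measure_pmf.expectation Lhat h + c * \<delta>"
      using \<kappa>d dq c by (intro add_left_mono mult_left_mono) auto
    also have "measure_pmf.expectation Lhat h \<le> measure_pmf.expectation p h + c * (\<Sum>a\<in>A\<times>B. \<bar>pmf Lhat a - pmf p a\<bar>)"
      using h by (intro expectation_le_l1[OF fAB LhatAB pAB]) auto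
    also have "c * (\<Sum>a\<in>A\<times>B. \<bar>pmf Lhat a - pmf p a\<bar>) \<le> c * \<delta>"
      using d c by (intro mult_left_mono)
    finally show ?thesis by (simp add: algebra_simps)
  qed
  ultimately show ?thesis
    by (intro exI[of _ f] exI[of _ g]) (simp add: Let_def J_def)
qed

section \<open>Conditioning on the side information\<close>

text \<open>Conditional laws of the first coordinate given the second, as a bind into which joint
  laws can be rewritten. \<open>K z\<close> is controlled only for \<open>z\<close> of positive
  probability.\<close>

lemma disintegrate_snd:
  fixes P :: "('a \<times> 'c) pmf"
  shows "\<exists>K. P = bind_pmf (map_pmf snd P) (\<lambda>z. map_pmf (\<lambda>x. (x, z)) (K z)) \<and>
    (\<forall>z\<in>set_pmf (map_pmf snd P). \<forall>x\<in>set_pmf (K z). (x, z) \<in> set_pmf P)"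
proof -
  define C where "C z = cond_pmf P {t. snd t = z}" for z
  have ne: "set_pmf P \<inter> {t. snd t = z} \<noteq> {}" if "z \<in> set_pmf (map_pmf snd P)" for z
    using that by auto
  have C: "set_pmf (C z) = set_pmf P \<inter> {t. snd t = z}" if "z \<in> set_pmf (map_pmf snd P)" for z
    unfolding C_def by (rule set_cond_pmf[OF ne[OF that]])
  have "bind_pmf (map_pmf snd P) C = P"
    unfolding C_def[abs_def]
    by (rule bind_cond_pmf_cancel) (auto simp: vimage_def eq_commute)
  also have "bind_pmf (map_pmf snd P) C = bind_pmf (map_pmf snd P) (\<lambda>z. map_pmf (\<lambda>x. (x, z)) (map_pmf fst (C z)))"
  proof (rule bind_pmf_cong[OF refl])
    fix z assume z: "z \<in> set_pmf (map_pmf snd P)"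
    have "map_pmf (\<lambda>x. (x, z)) (map_pmf fst (C z)) = map_pmf id (C z)"
      unfolding map_pmf_comp using C[OF z] by (intro map_pmf_cong) auto
    then show "C z = map_pmf (\<lambda>x. (x, z)) (map_pmf fst (C z))" by simp
  qed
  finally have "P = bind_pmf (map_pmf snd P) (\<lambda>z. map_pmf (\<lambda>x. (x, z)) (map_pmf fst (C z)))" by simp
  then show ?thesis using C by (intro exI[of _ "\<lambda>z. map_pmf fst (C z)"]) auto
qed

text \<open>Encoder and decoder both see \<open>z\<close>, so each value gets its own one-shot code
  and the errors are averaged. The event \<open>bad\<close> compares joint masses: it is the
  conditional likelihood-ratio event cleared of its denominators.\<close>

lemma one_shot_simulation_side_info:
  fixes P :: "('a \<times> 'c) pmf" and W :: "'a \<Rightarrow> 'c \<Rightarrow> 'b pmf" and T :: real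
  assumes fP: "finite (set_pmf P)" and fA: "finite A" and PA: "fst ` set_pmf P \<subseteq> A" and fB: "finite B"
    and WB: "\<And>x z. (x, z) \<in> set_pmf P \<Longrightarrow> set_pmf (W x z) \<subseteq> B"
    and T: "0 < T" and M: "0 < (M::nat)" and N: "0 < (N::nat)"
  defines "J \<equiv> chan_joint P W"
  defines "bad \<equiv> {(x, y, z). T * pmf (map_pmf snd J) (y, z) < pmf (W x z) y * pmf (map_pmf snd P) z}"
  defines "\<delta> \<equiv> 2 * (measure_pmf.prob J bad + T / M) + sqrt (card A * card B / N)"
  shows "\<exists>(f :: 'a \<Rightarrow> 'c \<Rightarrow> nat \<Rightarrow> nat pmf) (g :: nat \<Rightarrow> 'c \<Rightarrow> nat \<Rightarrow> 'b pmf).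
     (\<forall>x z k. set_pmf (f x z k) \<subseteq> {1..M}) \<and> (\<forall>m\<in>{1..M}. \<forall>z k. set_pmf (g m z k) \<subseteq> B) \<and>
     (let J' = bind_pmf P (\<lambda>(x, z). bind_pmf (pmf_of_set {1..N}) (\<lambda>k. bind_pmf (f x z k) (\<lambda>m.
                 map_pmf (\<lambda>y. (x, y, z)) (g m z k))))
      in map_pmf snd J' = map_pmf snd J \<and>
        (\<forall>d c. (\<forall>t. 0 \<le> d t \<and> d t \<le> c) \<longrightarrow>
           measure_pmf.expectation J' d \<le> measure_pmf.expectation J d + c * (2 * \<delta>)))"
proof -
  define Pz where "Pz = map_pmf snd P"
  obtain K where K: "P = bind_pmf Pz (\<lambda>z. map_pmf (\<lambda>x. (x, z)) (K z))"
    and Ks: "\<And>z x. z \<in> set_pmf Pz \<Longrightarrow> x \<in> set_pmf (K z) \<Longrightarrow> (x, z) \<in> set_pmf P"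
    using disintegrate_snd[of P] unfolding Pz_def by blast
  have fPz: "finite (set_pmf Pz)" using fP by (simp add: Pz_def)
  have KA: "set_pmf (K z) \<subseteq> A" if "z \<in> set_pmf Pz" for z using Ks[OF that] PA by force
  have fK: "finite (set_pmf (K z))" if "z \<in> set_pmf Pz" for z using KA[OF that] fA by (rule finite_subset)
  have KB: "set_pmf (W x z) \<subseteq> B" if "z \<in> set_pmf Pz" "x \<in> set_pmf (K z)" for x z using Ks[OF that] WB by blast
  define q where "q z = bind_pmf (K z) (\<lambda>x. W x z)" for z
  define p where "p z = bind_pmf (K z) (\<lambda>x. map_pmf (Pair x) (W x z))" for z
  define e where "e z = measure_pmf.prob (p z) {(x, y). T * pmf (q z) y < pmf (W x z) y}" for z
  define s where "s = T / M" 
  define r where "r = sqrt (card A * card B / N)"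
  define J' where "J' f g = bind_pmf P (\<lambda>(x, z). bind_pmf (pmf_of_set {1..N}) (\<lambda>k. bind_pmf (f x z k) (\<lambda>m.
                 map_pmf (\<lambda>y. (x, y, z)) (g m z k))))"
    for f :: "'a \<Rightarrow> 'c \<Rightarrow> nat \<Rightarrow> nat pmf" and g :: "nat \<Rightarrow> 'c \<Rightarrow> nat \<Rightarrow> 'b pmf"
  define Jz where "Jz z f g = bind_pmf (K z) (\<lambda>x. bind_pmf (pmf_of_set {1..N}) (\<lambda>k. bind_pmf (f x k) (\<lambda>m. map_pmf (Pair x) (g m k))))"
    for z and f :: "'a \<Rightarrow> nat \<Rightarrow> nat pmf" and g :: "nat \<Rightarrow> nat \<Rightarrow> 'b pmf"
  have "\<exists>f g. (\<forall>x k. set_pmf (f x k) \<subseteq> {1..M}) \<and> (\<forall>m\<in>{1..M}. \<forall>k. set_pmf (g m k) \<subseteq> B) \<and>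
     (z \<in> set_pmf Pz \<longrightarrow> map_pmf snd (Jz z f g) = q z \<and>
        (\<forall>d c. (\<forall>t. 0 \<le> d t \<and> d t \<le> c) \<longrightarrow>
           measure_pmf.expectation (Jz z f g) d \<le> measure_pmf.expectation (p z) d + c * (2 * (2 * (e z + s) + r))))" for z
  proof (cases "z \<in> set_pmf Pz")
    case True
    then show ?thesis
      using one_shot_simulation[of A "K z" B "\<lambda>x. W x z" T M N, OF fA KA[OF True] fB KB[OF True] T M N]
      unfolding Let_def q_def p_def e_def Jz_def s_def r_def by blast
  next
    case False
    \<comment> \<open>A value \<open>z\<close> of probability zero needs no good code, but still one
      with messages and outputs in range; constants do.\<close>
    obtain z0 where z0: "z0 \<in> set_pmf Pz" using set_pmf_not_empty[of Pz] by blast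
    obtain x0 where x0: "x0 \<in> set_pmf (K z0)" using set_pmf_not_empty[of "K z0"] by blast
    obtain b where "b \<in> B" using KB[OF z0 x0] set_pmf_not_empty[of "W x0 z0"] by blast
    with False M show ?thesis
      by (intro exI[of _ "\<lambda>_ _. return_pmf 1"] exI[of _ "\<lambda>_ _. return_pmf b"]) auto
  qed
  then obtain F G where FG: "\<And>z x k. set_pmf (F z x k) \<subseteq> {1..M}"
    "\<And>z m k. m \<in> {1..M} \<Longrightarrow> set_pmf (G z m k) \<subseteq> B"
    "\<And>z. z \<in> set_pmf Pz \<Longrightarrow> map_pmf snd (Jz z (F z) (G z)) = q z"
    "\<And>z d c. z \<in> set_pmf Pz \<Longrightarrow> (\<forall>t. 0 \<le> d t \<and> d t \<le> c) \<Longrightarrow>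
       measure_pmf.expectation (Jz z (F z) (G z)) d \<le> measure_pmf.expectation (p z) d + c * (2 * (2 * (e z + s) + r))"
    by metis
  define f where "f x z k = F z x k" for x z k
  define g where "g m z k = G z m k" for m z k
  have J': "J' f g = bind_pmf Pz (\<lambda>z. map_pmf (\<lambda>(x, y). (x, y, z)) (Jz z (F z) (G z)))"
    unfolding J'_def f_def g_def Jz_def
    by (subst K) (simp add: bind_assoc_pmf bind_map_pmf map_bind_pmf map_pmf_comp)
  have J: "J = bind_pmf Pz (\<lambda>z. map_pmf (\<lambda>(x, y). (x, y, z)) (p z))"
    unfolding J_def chan_joint_def p_def
    by (subst K) (simp add: bind_assoc_pmf bind_map_pmf map_bind_pmf map_pmf_comp)
  have sndJ: "map_pmf snd J = bind_pmf Pz (\<lambda>z. map_pmf (\<lambda>y. (y, z)) (q z))"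
    unfolding J p_def q_def by (simp add: map_bind_pmf map_pmf_comp)
  have "map_pmf snd (J' f g) = bind_pmf Pz (\<lambda>z. map_pmf (\<lambda>y. (y, z)) (map_pmf snd (Jz z (F z) (G z))))"
    unfolding J' by (simp add: map_bind_pmf map_pmf_comp case_prod_unfold)
  also have "\<dots> = map_pmf snd J"
    unfolding sndJ by (intro bind_pmf_cong refl) (simp add: FG(3))
  finally have snd: "map_pmf snd (J' f g) = map_pmf snd J" .
  have fp: "finite (set_pmf (p z))" if "z \<in> set_pmf Pz" for z
    using fK[OF that] KB[OF that] fB by (auto simp: p_def intro: finite_subset)
  have pmf_yz: "pmf (map_pmf snd J) (y, z) = pmf Pz z * pmf (q z) y" for y z
  proof -
    have "map_pmf snd J = map_pmf prod.swap (bind_pmf Pz (\<lambda>z. map_pmf (Pair z) (q z)))"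
      unfolding sndJ by (simp add: map_bind_pmf map_pmf_comp)
    then have "pmf (map_pmf snd J) (y, z) = pmf (map_pmf prod.swap (bind_pmf Pz (\<lambda>z. map_pmf (Pair z) (q z)))) (prod.swap (z, y))"
      by simp
    also have "\<dots> = pmf Pz z * pmf (q z) y"
      by (subst pmf_map_inj') (auto simp: pmf_bind_map_Pair)
    finally show ?thesis .
  qed
  have EJ: "measure_pmf.expectation J d = measure_pmf.expectation Pz (\<lambda>z. measure_pmf.expectation (p z) (\<lambda>(x, y). d (x, y, z)))"
    for d :: "_ \<Rightarrow> real"
    unfolding J using fPz fp by (subst expectation_bind_finite) (auto simp: case_prod_unfold)
  have "measure_pmf.prob J bad = measure_pmf.expectation J (indicator bad)" by simp
  also have "\<dots> = measure_pmf.expectation Pz (\<lambda>z. measure_pmf.expectation (p z) (indicator {(x, y). T * pmf (q z) y < pmf (W x z) y}))"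
    unfolding EJ
  proof (intro expectation_cong_pmf)
    \<comment> \<open>Multiplying the conditional comparison by the positive \<open>pmf Pz z\<close>
      gives the comparison of joint masses in \<open>bad\<close>.\<close>
    fix z t assume "z \<in> set_pmf Pz"
    then have "0 < pmf Pz z" by (simp add: pmf_positive)
    then show "(case t of (x, y) \<Rightarrow> indicat_real bad (x, y, z)) = indicator {(x, y). T * pmf (q z) y < pmf (W x z) y} t"
      by (cases t) (simp add: bad_def indicator_def pmf_yz Pz_def[symmetric] mult.commute mult.left_commute)
  qed
  finally have bad: "measure_pmf.prob J bad = measure_pmf.expectation Pz e" by (simp add: e_def[abs_def])
  have intg: "integrable (measure_pmf Pz) h" for h :: "_ \<Rightarrow> real" using fPz by (rule integrable_measure_pmf_finite)
  have "measure_pmf.expectation (J' f g) d \<le> measure_pmf.expectation J d + c * (2 * \<delta>)"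
    if d: "\<forall>t. 0 \<le> d t \<and> d t \<le> c" for d c
  proof -
    have "finite (set_pmf (Jz z (F z) (G z)))" if "z \<in> set_pmf Pz" for z
    proof -
      have "set_pmf (Jz z (F z) (G z)) \<subseteq> A \<times> B"
      proof
        fix t assume "t \<in> set_pmf (Jz z (F z) (G z))"
        then obtain x k m y where "x \<in> set_pmf (K z)" "m \<in> set_pmf (F z x k)" "y \<in> set_pmf (G z m k)" "t = (x, y)"
          by (auto simp: Jz_def)
        then show "t \<in> A \<times> B" using FG(1)[of z x k] FG(2)[of m z k] KA[OF that] by blast
      qed
      then show ?thesis by (rule finite_subset) (use fA fB in simp)
    qed
    then have "measure_pmf.expectation (J' f g) d
       = measure_pmf.expectation Pz (\<lambda>z. measure_pmf.expectation (Jz z (F z) (G z)) (\<lambda>(x, y). d (x, y, z)))"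
      unfolding J' using fPz by (subst expectation_bind_finite) (auto simp: case_prod_unfold)
    also have "\<dots> \<le> measure_pmf.expectation Pz (\<lambda>z. measure_pmf.expectation (p z) (\<lambda>(x, y). d (x, y, z)) + c * (2 * (2 * (e z + s) + r)))"
      using d by (intro expectation_mono_finite[OF fPz] FG(4)) auto
    also have "\<dots> = measure_pmf.expectation J d + c * (2 * \<delta>)"
      by (simp add: EJ intg bad \<delta>_def s_def r_def)
    finally show ?thesis .
  qed
  moreover have "\<forall>x z k. set_pmf (f x z k) \<subseteq> {1..M}" "\<forall>m\<in>{1..M}. \<forall>z k. set_pmf (g m z k) \<subseteq> B"
    using FG(1,2) unfolding f_def g_def by blast+
  ultimately show ?thesis using snd unfolding Let_def J'_def by blast
qed

subsection \<open>Single-letter rate bound for codes\<close>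

text \<open>Conditional information density of \<open>x\<close> and \<open>y\<close> given
  \<open>z\<close>, written with joint masses. Its values off the support carry no weight in
  expectations under \<open>J\<close>.\<close>

definition info_density :: "('x \<times> 'y \<times> 'z) pmf \<Rightarrow> 'x \<times> 'y \<times> 'z \<Rightarrow> real" where
  "info_density J = (\<lambda>(x, y, z). log 2 (pmf J (x, y, z) * pmf (map_pmf (\<lambda>t. snd (snd t)) J) z /
     (pmf (map_pmf (\<lambda>(x, y, z). (x, z)) J) (x, z) * pmf (map_pmf snd J) (y, z))))"

lemma simple_distributed_pmf:
  fixes J :: "'a::finite pmf"
  shows "simple_distributed (measure_pmf J) X (\<lambda>t. pmf (map_pmf X J) t)"
  by (rule measure_pmf.simple_distributedI) (auto simp: simple_function_def pmf_map)

lemma cond_MI_eq: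
  fixes J :: "('x::finite \<times> 'y::finite \<times> 'z::finite) pmf"
  shows "cond_MI J = measure_pmf.expectation J (info_density J)"
proof -
  interpret information_space "measure_pmf J" 2 by unfold_locales simp
  have [simp]: "(\<lambda>t. fst (snd t)) ` (UNIV :: ('x \<times> 'y \<times> 'z) set) = UNIV"
    "(\<lambda>t. snd (snd t)) ` (UNIV :: ('x \<times> 'y \<times> 'z) set) = UNIV"
    "(fst :: 'x \<times> 'y \<times> 'z \<Rightarrow> 'x) ` UNIV = UNIV"
    by (auto simp: image_def)
  have id: "(\<lambda>t::'x \<times> 'y \<times> 'z. (fst t, fst (snd t), snd (snd t))) = (\<lambda>t. t)"
    "(\<lambda>t::'x \<times> 'y \<times> 'z. (fst (snd t), snd (snd t))) = snd"
    "(\<lambda>t::'x \<times> 'y \<times> 'z. (fst t, snd (snd t))) = (\<lambda>(x, y, z). (x, z))"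
    by auto
  have "cond_MI J = (\<Sum>(x, y, z)\<in>UNIV. pmf J (x, y, z) * log 2 (pmf J (x, y, z) /
      (pmf (map_pmf (\<lambda>(x, y, z). (x, z)) J) (x, z) * (pmf (map_pmf snd J) (y, z) / pmf (map_pmf (\<lambda>t. snd (snd t)) J) z))))"
    using conditional_mutual_information_eq[of "\<lambda>t. snd (snd t)" "pmf (map_pmf (\<lambda>t. snd (snd t)) J)" "\<lambda>t. fst (snd t)"
        "pmf (map_pmf (\<lambda>t. (fst (snd t), snd (snd t))) J)" fst "pmf (map_pmf (\<lambda>t. (fst t, snd (snd t))) J)"
        "pmf (map_pmf (\<lambda>t. (fst t, fst (snd t), snd (snd t))) J)", OF simple_distributed_pmf simple_distributed_pmf simple_distributed_pmf simple_distributed_pmf]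
    by (simp add: cond_MI_def id)
  also have "\<dots> = (\<Sum>t\<in>UNIV. info_density J t * pmf J t)"
    by (intro sum.cong) (auto simp: info_density_def mult.commute)
  also have "\<dots> = measure_pmf.expectation J (info_density J)"
    by (intro integral_measure_pmf_real[symmetric]) auto
  finally show ?thesis .
qed

lemma finite_idx [simp]: "finite (idx m)"
  by (simp add: idx_def)

section \<open>Change of measure for block laws\<close>

lemma sum_lists_prod:
  fixes h :: "nat \<Rightarrow> 'a::finite \<Rightarrow> real"
  shows "(\<Sum>xs | length xs = n. \<Prod>i<n. h i (xs ! i)) = (\<Prod>i<n. \<Sum>x\<in>UNIV. h i x)"
proof (induction n arbitrary: h)
  case (Suc n)
  have "(\<Sum>xs | length xs = Suc n. \<Prod>i<Suc n. h i (xs ! i))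
     = (\<Sum>(x, xs)\<in>UNIV \<times> {xs. length xs = n}. \<Prod>i<Suc n. h i ((x # xs) ! i))"
    by (rule sum.reindex_bij_witness[of _ "\<lambda>(x, xs). x # xs" "\<lambda>xs. (hd xs, tl xs)"]) (auto simp: length_Suc_conv)
  also have "\<dots> = (\<Sum>x\<in>UNIV. h 0 x * (\<Sum>xs | length xs = n. \<Prod>i<n. h (Suc i) (xs ! i)))"
    by (simp add: prod.lessThan_Suc_shift sum.cartesian_product' sum_distrib_left del: prod.lessThan_Suc)
  also have "\<dots> = (\<Prod>i<Suc n. \<Sum>x\<in>UNIV. h i x)"
    by (simp add: Suc.IH[of "\<lambda>i. h (Suc i)"] prod.lessThan_Suc_shift sum_distrib_right del: prod.lessThan_Suc)
  finally show ?case .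
qed simp

lemma sum_pair_lists:
  fixes \<phi> :: "'a::finite list \<Rightarrow> 'b::finite list \<Rightarrow> real"
  shows "(\<Sum>l | length l = n. \<phi> (map fst l) (map snd l)) = (\<Sum>zs | length zs = n. \<Sum>xs | length xs = n. \<phi> xs zs)"
proof -
  have "(\<Sum>l | length l = n. \<phi> (map fst l) (map snd l))
     = (\<Sum>(zs, xs)\<in>{zs. length zs = n} \<times> {xs. length xs = n}. \<phi> xs zs)"
    by (rule sum.reindex_bij_witness[of _ "\<lambda>(zs, xs). zip xs zs" "\<lambda>l. (map snd l, map fst l)"])
       (auto simp: zip_map_fst_snd)
  then show ?thesis by (simp add: sum.cartesian_product')
qed

text \<open>Think of \<open>u\<close> as the likelihood ratio of \<open>x\<close> given
  \<open>(y, z)\<close> against \<open>x\<close> given \<open>z\<close>. When \<open>ys\<close> is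
  generated from \<open>zs\<close> alone, \<open>xs\<close> can be summed out first; the sum
  factorises over time and each factor is at most the mass of \<open>zs ! i\<close>.\<close>

lemma expectation_iid_change_of_measure:
  fixes P :: "('x::finite \<times> 'z::finite) pmf" and u :: "'x \<Rightarrow> 'y::finite \<Rightarrow> 'z \<Rightarrow> real"
    and h :: "'z list \<Rightarrow> 'y list pmf"
  assumes u0: "\<And>x y z. 0 \<le> u x y z"
    and u1: "\<And>y z. (\<Sum>x\<in>UNIV. pmf P (x, z) * u x y z) \<le> pmf (map_pmf snd P) z"
    and h: "\<And>zs. length zs = n \<Longrightarrow> set_pmf (h zs) \<subseteq> {ys. length ys = n}"
  shows "measure_pmf.expectation (iid_pmf n P) (\<lambda>l. measure_pmf.expectation (h (map snd l))
      (\<lambda>ys. \<Prod>i<n. u (map fst l ! i) (ys ! i) (map snd l ! i))) \<le> 1"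
proof -
  note fin = finite_lists_of_length[of n]
  define U where "U xs ys zs = (\<Prod>i<n. u (xs ! i) (ys ! i) (zs ! i))" for xs ys zs
  have "measure_pmf.expectation (iid_pmf n P) (\<lambda>l. measure_pmf.expectation (h (map snd l)) (\<lambda>ys. U (map fst l) ys (map snd l)))
     = (\<Sum>l | length l = n. measure_pmf.expectation (h (map snd l)) (\<lambda>ys. U (map fst l) ys (map snd l)) * pmf (iid_pmf n P) l)"
    by (rule integral_measure_pmf_real[OF fin]) (auto dest: length_iid_pmf)
  also have "\<dots> = (\<Sum>l | length l = n. (\<Sum>ys | length ys = n. U (map fst l) ys (map snd l) * pmf (h (map snd l)) ys)
      * (\<Prod>i<n. pmf P (map fst l ! i, map snd l ! i)))"
  proof (rule sum.cong[OF refl])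
    fix l :: "('x \<times> 'z) list" assume "l \<in> {l. length l = n}"
    then have l: "length l = n" by simp
    have "measure_pmf.expectation (h (map snd l)) (\<lambda>ys. U (map fst l) ys (map snd l))
       = (\<Sum>ys | length ys = n. U (map fst l) ys (map snd l) * pmf (h (map snd l)) ys)"
      using h[of "map snd l"] l by (intro integral_measure_pmf_real[OF fin]) auto
    moreover have "pmf (iid_pmf n P) l = (\<Prod>i<n. pmf P (map fst l ! i, map snd l ! i))"
      using l by (simp add: pmf_iid_pmf)
    ultimately show "measure_pmf.expectation (h (map snd l)) (\<lambda>ys. U (map fst l) ys (map snd l)) * pmf (iid_pmf n P) l
       = (\<Sum>ys | length ys = n. U (map fst l) ys (map snd l) * pmf (h (map snd l)) ys) * (\<Prod>i<n. pmf P (map fst l ! i, map snd l ! i))"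
      by simp
  qed
  also have "\<dots> = (\<Sum>zs | length zs = n. \<Sum>xs | length xs = n. (\<Sum>ys | length ys = n. U xs ys zs * pmf (h zs) ys) * (\<Prod>i<n. pmf P (xs ! i, zs ! i)))"
    by (rule sum_pair_lists[where \<phi> = "\<lambda>xs zs. (\<Sum>ys | length ys = n. U xs ys zs * pmf (h zs) ys) * (\<Prod>i<n. pmf P (xs ! i, zs ! i))"])
  also have "\<dots> = (\<Sum>zs | length zs = n. \<Sum>ys | length ys = n. pmf (h zs) ys *
      (\<Sum>xs | length xs = n. \<Prod>i<n. pmf P (xs ! i, zs ! i) * u (xs ! i) (ys ! i) (zs ! i)))"
    by (rule sum.cong[OF refl], simp only: sum_distrib_left sum_distrib_right, subst sum.swap)
       (simp add: U_def prod.distrib mult.commute mult.left_commute)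
  also have "\<dots> = (\<Sum>zs | length zs = n. \<Sum>ys | length ys = n. pmf (h zs) ys * (\<Prod>i<n. \<Sum>x\<in>UNIV. pmf P (x, zs ! i) * u x (ys ! i) (zs ! i)))"
    by (subst sum_lists_prod) (rule refl)
  also have "\<dots> \<le> (\<Sum>zs | length zs = n. \<Sum>ys | length ys = n. pmf (h zs) ys * (\<Prod>i<n. pmf (map_pmf snd P) (zs ! i)))"
    by (intro sum_mono mult_left_mono prod_mono) (auto intro!: sum_nonneg mult_nonneg_nonneg u1 u0)
  also have "\<dots> = (\<Sum>zs | length zs = n. pmf (iid_pmf n (map_pmf snd P)) zs)"
    by (intro sum.cong refl) (simp add: pmf_iid_pmf sum_pmf_eq_1[OF finite_lists_of_length h] flip: sum_distrib_right)
  also have "\<dots> = 1"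
    using fin by (intro sum_pmf_eq_1) (auto dest: length_iid_pmf)
  finally show ?thesis by (simp add: U_def)
qed

section \<open>Joint law of a valid code\<close>

context
  fixes P :: "('x::finite \<times> 'z::finite) pmf" and n :: nat and M M0 :: real
    and f :: "'x list \<Rightarrow> 'z list \<Rightarrow> nat \<Rightarrow> nat pmf" and g :: "nat \<Rightarrow> 'z list \<Rightarrow> nat \<Rightarrow> 'x list pmf"
  assumes code: "valid_code n M M0 f g"
begin

lemma code_key: "finite (idx M0)" "idx M0 \<noteq> {}" "set_pmf (pmf_of_set (idx M0)) = idx M0"
  using code by (auto simp: valid_code_def intro!: set_pmf_of_set)

lemma code_msg: "length xs = n \<Longrightarrow> length zs = n \<Longrightarrow> k \<in> idx M0 \<Longrightarrow> set_pmf (f xs zs k) \<subseteq> idx M"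
  using code by (auto simp: valid_code_def)

lemma code_out: "m \<in> idx M \<Longrightarrow> length zs = n \<Longrightarrow> k \<in> idx M0 \<Longrightarrow> set_pmf (g m zs k) \<subseteq> {ys. length ys = n}"
  using code by (auto simp: valid_code_def)

lemma length_code_joint:
  assumes "(xs, zs, k, ys) \<in> set_pmf (code_joint P n M0 f g)"
  shows "length xs = n" "length zs = n" "length ys = n" "k \<in> idx M0"
proof -
  obtain l m where l: "l \<in> set_pmf (iid_pmf n P)" "xs = map fst l" "zs = map snd l" and k: "k \<in> idx M0"
    and m: "m \<in> set_pmf (f xs zs k)" "ys \<in> set_pmf (g m zs k)"
    using assms code_key by (auto simp: code_joint_def)
  from l show xs: "length xs = n" and zs: "length zs = n" by (auto dest: length_iid_pmf)
  show "k \<in> idx M0" by fact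
  show "length ys = n" using code_msg[OF xs zs k] m code_out[OF _ zs k] by blast
qed

lemma finite_code_joint: "finite (set_pmf (code_joint P n M0 f g))"
proof (rule finite_subset)
  show "set_pmf (code_joint P n M0 f g) \<subseteq> {xs. length xs = n} \<times> {zs. length zs = n} \<times> idx M0 \<times> {ys. length ys = n}"
    using length_code_joint by auto
  show "finite ({xs::'x list. length xs = n} \<times> {zs::'z list. length zs = n} \<times> idx M0 \<times> {ys::'x list. length ys = n})"
    by (intro finite_cartesian_product finite_lists_of_length finite_idx)
qed

lemma card_idx_pos: "0 < card (idx M)"
proof -
  obtain t where "t \<in> set_pmf (code_joint P n M0 f g)" using set_pmf_not_empty[of "code_joint P n M0 f g"] by blast
  then obtain m where "m \<in> idx M"
    using code_key code_msg by (fastforce simp: code_joint_def dest: length_iid_pmf)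
  then show ?thesis by (auto simp: card_gt_0_iff)
qed

text \<open>With key and message held fixed, the output depends on the source only through
  \<open>zs\<close>, so the preceding bound gives 1. Summing over the messages gives their
  number.\<close>

lemma expectation_code_change_of_measure:
  fixes u :: "'x \<Rightarrow> 'x \<Rightarrow> 'z \<Rightarrow> real"
  assumes u0: "\<And>x y z. 0 \<le> u x y z"
    and u1: "\<And>y z. (\<Sum>x\<in>UNIV. pmf P (x, z) * u x y z) \<le> pmf (map_pmf snd P) z"
  shows "measure_pmf.expectation (code_joint P n M0 f g)
     (\<lambda>(xs, zs, k, ys). \<Prod>i<n. u (xs ! i) (ys ! i) (zs ! i)) \<le> card (idx M)"
proof -
  define U where "U xs ys zs = (\<Prod>i<n. u (xs ! i) (ys ! i) (zs ! i))" for xs ys zs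
  have U0: "0 \<le> U xs ys zs" for xs ys zs unfolding U_def by (intro prod_nonneg) (simp add: u0)
  have finI: "finite (set_pmf (iid_pmf n P))" by (intro finite_set_iid_pmf) simp
  let ?E = "\<lambda>k. measure_pmf.expectation (iid_pmf n P) (\<lambda>l. measure_pmf.expectation (f (map fst l) (map snd l) k)
      (\<lambda>m. measure_pmf.expectation (g m (map snd l) k) (\<lambda>ys. U (map fst l) ys (map snd l))))"
  have fin_f: "finite (set_pmf (f (map fst l) (map snd l) k))" if "l \<in> set_pmf (iid_pmf n P)" "k \<in> idx M0" for l k
    using that code_msg[of "map fst l" "map snd l" k] finite_subset[OF _ finite_idx] by (auto dest!: length_iid_pmf)
  have fin_g: "finite (set_pmf (g m (map snd l) k))" if "l \<in> set_pmf (iid_pmf n P)" "k \<in> idx M0"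
    "m \<in> set_pmf (f (map fst l) (map snd l) k)" for l k m
  proof (rule finite_subset[OF code_out finite_lists_of_length])
    show "length (map snd l) = n" using that length_iid_pmf by auto
    show "m \<in> idx M" using that code_msg[of "map fst l" "map snd l" k] length_iid_pmf[OF that(1)] by auto
  qed fact
  \<comment> \<open>The key is independent of the source, so it may be drawn first and then held
    fixed.\<close>
  have "code_joint P n M0 f g = bind_pmf (pmf_of_set (idx M0)) (\<lambda>k. bind_pmf (iid_pmf n P) (\<lambda>xzs.
     bind_pmf (f (map fst xzs) (map snd xzs) k) (\<lambda>m.
     map_pmf (\<lambda>ys. (map fst xzs, map snd xzs, k, ys)) (g m (map snd xzs) k))))"
    unfolding code_joint_def by (rule bind_commute_pmf)
  then have "measure_pmf.expectation (code_joint P n M0 f g) (\<lambda>(xs, zs, k, ys). U xs ys zs)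
     = measure_pmf.expectation (pmf_of_set (idx M0)) (\<lambda>k. measure_pmf.expectation (bind_pmf (iid_pmf n P) (\<lambda>xzs.
     bind_pmf (f (map fst xzs) (map snd xzs) k) (\<lambda>m.
     map_pmf (\<lambda>ys. (map fst xzs, map snd xzs, k, ys)) (g m (map snd xzs) k)))) (\<lambda>(xs, zs, k, ys). U xs ys zs))"
    using code_key finI fin_f fin_g by (simp only:) (rule expectation_bind_finite, auto)
  also have "\<dots> = measure_pmf.expectation (pmf_of_set (idx M0)) ?E"
  proof (rule expectation_cong_pmf)
    fix k assume "k \<in> set_pmf (pmf_of_set (idx M0))"
    then have k: "k \<in> idx M0" using code_key by simp
    show "measure_pmf.expectation (bind_pmf (iid_pmf n P) (\<lambda>xzs. bind_pmf (f (map fst xzs) (map snd xzs) k) (\<lambda>m.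
       map_pmf (\<lambda>ys. (map fst xzs, map snd xzs, k, ys)) (g m (map snd xzs) k)))) (\<lambda>(xs, zs, k, ys). U xs ys zs) = ?E k"
      using finI fin_f[OF _ k] fin_g[OF _ k]
      by (subst expectation_bind_finite) (auto intro!: expectation_cong_pmf simp: expectation_bind_finite)
  qed
  also have "\<dots> \<le> measure_pmf.expectation (pmf_of_set (idx M0)) (\<lambda>k. card (idx M))"
  proof (rule expectation_mono_finite)
    show "finite (set_pmf (pmf_of_set (idx M0)))" using code_key by simp
    fix k assume "k \<in> set_pmf (pmf_of_set (idx M0))"
    then have k: "k \<in> idx M0" using code_key by simp
    let ?\<phi> = "\<lambda>l m. measure_pmf.expectation (g m (map snd l) k) (\<lambda>ys. U (map fst l) ys (map snd l))"
    have "?E k \<le> measure_pmf.expectation (iid_pmf n P) (\<lambda>l. \<Sum>m\<in>idx M. ?\<phi> l m)"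
    proof (rule expectation_mono_finite[OF finI])
      fix l assume l: "l \<in> set_pmf (iid_pmf n P)"
      have "measure_pmf.expectation (f (map fst l) (map snd l) k) (?\<phi> l)
          = (\<Sum>m\<in>idx M. ?\<phi> l m * pmf (f (map fst l) (map snd l) k) m)"
        using code_msg[of "map fst l" "map snd l" k] k l
        by (intro integral_measure_pmf_real) (auto dest!: length_iid_pmf)
      \<comment> \<open>Bounding the message probability by 1 removes the only dependence of the
        message on \<open>xs\<close>; this is where the rate is paid.\<close>
      also have "\<dots> \<le> (\<Sum>m\<in>idx M. ?\<phi> l m)"
        by (intro sum_mono mult_left_le) (auto simp: pmf_le_1 U0 intro!: Bochner_Integration.integral_nonneg)
      finally show "measure_pmf.expectation (f (map fst l) (map snd l) k) (?\<phi> l) \<le> (\<Sum>m\<in>idx M. ?\<phi> l m)" .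
    qed
    also have "\<dots> = (\<Sum>m\<in>idx M. measure_pmf.expectation (iid_pmf n P) (\<lambda>l. ?\<phi> l m))"
      using finI by (intro Bochner_Integration.integral_sum integrable_measure_pmf_finite)
    also have "\<dots> \<le> (\<Sum>m\<in>idx M. 1)"
      unfolding U_def using code_out k
      by (intro sum_mono expectation_iid_change_of_measure u0 u1) auto
    finally show "?E k \<le> card (idx M)" by simp
  qed
  finally show ?thesis by (simp add: U_def)
qed

end

section \<open>Averaging over time\<close>

definition time_average :: "nat \<Rightarrow> ('x list \<times> 'z list \<times> nat \<times> 'x list) pmf \<Rightarrow> ('x \<times> 'x \<times> 'z) pmf" where
  "time_average n J = bind_pmf (pmf_of_set {..<n}) (\<lambda>i. map_pmf (\<lambda>(xs, zs, k, ys). (xs ! i, ys ! i, zs ! i)) J)"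

lemma expectation_time_average:
  fixes h :: "_ \<Rightarrow> real"
  assumes "0 < n" "finite (set_pmf J)"
  shows "real n * measure_pmf.expectation (time_average n J) h
    = measure_pmf.expectation J (\<lambda>(xs, zs, k, ys). \<Sum>i<n. h (xs ! i, ys ! i, zs ! i))"
proof -
  have ne: "{..<n} \<noteq> {}" using assms by auto
  have "measure_pmf.expectation (time_average n J) h
    = measure_pmf.expectation (pmf_of_set {..<n}) (\<lambda>i. measure_pmf.expectation J (\<lambda>(xs, zs, k, ys). h (xs ! i, ys ! i, zs ! i)))"
    unfolding time_average_def using assms ne by (subst expectation_bind_finite) (auto simp: case_prod_unfold)
  also have "\<dots> = (\<Sum>i<n. measure_pmf.expectation J (\<lambda>(xs, zs, k, ys). h (xs ! i, ys ! i, zs ! i))) / n"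
    using ne by (subst integral_pmf_of_set) auto
  also have "(\<Sum>i<n. measure_pmf.expectation J (\<lambda>(xs, zs, k, ys). h (xs ! i, ys ! i, zs ! i)))
    = measure_pmf.expectation J (\<lambda>(xs, zs, k, ys). \<Sum>i<n. h (xs ! i, ys ! i, zs ! i))"
    using assms by (simp add: case_prod_unfold Bochner_Integration.integral_sum integrable_measure_pmf_finite)
  finally show ?thesis using assms by simp
qed

lemma map_time_average:
  assumes n: "0 < n" and h: "\<And>i. i < n \<Longrightarrow> map_pmf (\<lambda>(xs, zs, k, ys). h (xs ! i, ys ! i, zs ! i)) J = q"
  shows "map_pmf h (time_average n J) = q"
proof -
  have ne: "{..<n} \<noteq> {}" using n by auto
  have "map_pmf h (time_average n J)
     = bind_pmf (pmf_of_set {..<n}) (\<lambda>i. map_pmf (\<lambda>(xs, zs, k, ys). h (xs ! i, ys ! i, zs ! i)) J)"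
    by (simp add: time_average_def map_bind_pmf map_pmf_comp case_prod_unfold)
  also have "\<dots> = bind_pmf (pmf_of_set {..<n}) (\<lambda>i. q)"
    using h ne by (intro bind_pmf_cong refl) (simp add: set_pmf_of_set)
  finally show ?thesis by simp
qed

lemma map_code_joint_source:
  "map_pmf (\<lambda>(xs, zs, k, ys). h xs zs) (code_joint P n M0 f g) = map_pmf (\<lambda>l. h (map fst l) (map snd l)) (iid_pmf n P)"
  by (simp add: code_joint_def map_bind_pmf map_pmf_comp) (simp add: map_pmf_def)

lemma time_average_source:
  assumes "0 < n"
  shows "map_pmf (\<lambda>(x, y, z). (x, z)) (time_average n (code_joint P n M0 f g)) = P"
proof (rule map_time_average[OF assms])
  fix i assume i: "i < n"
  have "map_pmf (\<lambda>(xs, zs, k, ys). case (xs ! i, ys ! i, zs ! i) of (x, y, z) \<Rightarrow> (x, z)) (code_joint P n M0 f g)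
     = map_pmf (\<lambda>l. (map fst l ! i, map snd l ! i)) (iid_pmf n P)"
    using map_code_joint_source[of "\<lambda>xs zs. (xs ! i, zs ! i)" P n M0 f g] by simp
  also have "\<dots> = map_pmf (\<lambda>l. l ! i) (iid_pmf n P)"
    using i by (intro map_pmf_cong refl) (auto dest!: length_iid_pmf)
  also have "\<dots> = P" by (rule map_nth_iid_pmf[OF i])
  finally show "map_pmf (\<lambda>(xs, zs, k, ys). case (xs ! i, ys ! i, zs ! i) of (x, y, z) \<Rightarrow> (x, z)) (code_joint P n M0 f g) = P" .
qed

text \<open>The ratio \<open>u\<close> is built from the time average \<open>Q\<close> itself, so
  the expected logarithm of its product along the block is \<open>n * cond_MI Q\<close>. Concavity
  of the logarithm and the change of measure bound this by the logarithm of the number of messages;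
  no chain rule over time is involved.\<close>

lemma code_rate_bound:
  fixes P :: "('x::finite \<times> 'z::finite) pmf"
  assumes code: "valid_code n M M0 f g" and n: "0 < n"
  shows "real n * cond_MI (time_average n (code_joint P n M0 f g)) \<le> log 2 (card (idx M))"
proof -
  define J where "J = code_joint P n M0 f g"
  define Q where "Q = time_average n J"
  define Pz where "Pz = map_pmf snd P"
  define u where "u x y z = pmf Q (x, y, z) * pmf Pz z / (pmf P (x, z) * pmf (map_pmf snd Q) (y, z))" for x y z
  have Qxz: "map_pmf (\<lambda>(x, y, z). (x, z)) Q = P"
    unfolding Q_def J_def by (rule time_average_source[OF n])
  have Qz: "map_pmf (\<lambda>t. snd (snd t)) Q = Pz"
    unfolding Pz_def Qxz[symmetric] by (simp add: map_pmf_comp case_prod_unfold)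
  have dens: "info_density Q (x, y, z) = log 2 (u x y z)" for x y z
    by (simp add: info_density_def u_def Qxz Qz)
  have u0: "0 \<le> u x y z" for x y z by (simp add: u_def)
  have u1: "(\<Sum>x\<in>UNIV. pmf P (x, z) * u x y z) \<le> pmf (map_pmf snd P) z" for y z
  proof -
    have "(\<Sum>x\<in>UNIV. pmf P (x, z) * u x y z) \<le> (\<Sum>x\<in>UNIV. pmf Q (x, y, z) * pmf Pz z / pmf (map_pmf snd Q) (y, z))"
      by (intro sum_mono) (simp add: u_def)
    also have "\<dots> = (\<Sum>x\<in>UNIV. pmf Q (x, y, z)) * pmf Pz z / pmf (map_pmf snd Q) (y, z)"
      by (simp add: sum_distrib_right sum_divide_distrib)
    also have "(\<Sum>x\<in>UNIV. pmf Q (x, y, z)) = pmf (map_pmf snd Q) (y, z)"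
      by (subst pmf_map_snd_finite[of UNIV]) auto
    \<comment> \<open>At a pair of mass zero, division by zero makes the left side 0; elsewhere the
      bound is attained. This is why \<open>u1\<close> is an inequality.\<close>
    finally show ?thesis by (cases "pmf (map_pmf snd Q) (y, z) = 0") (auto simp: Pz_def intro: order_trans[OF _ pmf_nonneg])
  qed
  have fin: "finite (set_pmf J)" unfolding J_def by (rule finite_code_joint[OF code])
  have upos: "0 < u (xs ! i) (ys ! i) (zs ! i)" if "(xs, zs, k, ys) \<in> set_pmf J" "i < n" for xs zs k ys i
  proof -
    have "{..<n} \<noteq> {}" using n by auto
    then have "set_pmf Q = (\<Union>i<n. (\<lambda>(xs, zs, k, ys). (xs ! i, ys ! i, zs ! i)) ` set_pmf J)"
      by (simp add: Q_def time_average_def)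
    then have q: "(xs ! i, ys ! i, zs ! i) \<in> set_pmf Q" using that by force
    then have "(ys ! i, zs ! i) \<in> set_pmf (map_pmf snd Q)" "(xs ! i, zs ! i) \<in> set_pmf P" "zs ! i \<in> set_pmf Pz"
      unfolding Qxz[symmetric] Qz[symmetric] by force+
    with q show ?thesis by (auto simp: u_def pmf_positive intro!: divide_pos_pos mult_pos_pos)
  qed
  define m where "m = real (card (idx M))"
  have m: "0 < m" using card_idx_pos[OF code] by (simp add: m_def)
  let ?U = "\<lambda>(xs, zs, k, ys). \<Prod>i<n. u (xs ! i) (ys ! i) (zs ! i)"
  have "real n * cond_MI Q = measure_pmf.expectation J (\<lambda>(xs, zs, k, ys). \<Sum>i<n. info_density Q (xs ! i, ys ! i, zs ! i))"
    unfolding cond_MI_eq Q_def by (rule expectation_time_average[OF n fin])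
  also have "\<dots> \<le> measure_pmf.expectation J (\<lambda>t. log 2 m + (?U t / m - 1) / ln 2)"
  proof (rule expectation_mono_finite[OF fin])
    fix t assume t: "t \<in> set_pmf J"
    obtain xs zs k ys where t': "t = (xs, zs, k, ys)" by (cases t) auto
    have pos: "0 < ?U t" unfolding t' prod.case using t t' by (intro prod_pos) (auto intro: upos)
    have "(\<Sum>i<n. info_density Q (xs ! i, ys ! i, zs ! i)) = log 2 (?U t)"
      unfolding t' prod.case log_def dens using upos t t'
      by (subst ln_prod) (force simp: sum_divide_distrib)+
    also have "\<dots> = log 2 m + ln (?U t / m) / ln 2"
      using pos m by (simp add: log_def ln_div diff_divide_distrib)
    \<comment> \<open>Tangent of \<open>ln\<close> at 1. After scaling by \<open>m\<close>, the
      linear term has nonpositive expectation.\<close>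
    also have "\<dots> \<le> log 2 m + (?U t / m - 1) / ln 2"
      using pos m by (intro add_left_mono divide_right_mono ln_le_minus_one divide_pos_pos) auto
    finally show "(case t of (xs, zs, k, ys) \<Rightarrow> \<Sum>i<n. info_density Q (xs ! i, ys ! i, zs ! i)) \<le> log 2 m + (?U t / m - 1) / ln 2"
      by (simp add: t')
  qed
  also have "\<dots> = log 2 m + (measure_pmf.expectation J ?U / m - 1) / ln 2"
    using fin by (simp add: integrable_measure_pmf_finite)
  also have "\<dots> \<le> log 2 m"
  proof -
    have "measure_pmf.expectation J ?U \<le> m"
      unfolding J_def m_def by (rule expectation_code_change_of_measure[OF code u0 u1])
    then show ?thesis using m by (simp add: divide_nonpos_pos)
  qed
  finally show ?thesis by (simp add: Q_def J_def m_def)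
qed

subsection \<open>Simulation of a memoryless channel\<close>

text \<open>Memoryless extension of \<open>W\<close>. The second equation ends the recursion; lists
  of different lengths have probability zero under the block source.\<close>

fun prod_chan :: "('x \<Rightarrow> 'z \<Rightarrow> 'y pmf) \<Rightarrow> 'x list \<Rightarrow> 'z list \<Rightarrow> 'y list pmf" where
  "prod_chan W (x # xs) (z # zs) = bind_pmf (W x z) (\<lambda>y. map_pmf (\<lambda>ys. y # ys) (prod_chan W xs zs))"
| "prod_chan W _ _ = return_pmf []"

lemma length_prod_chan:
  "length xs = n \<Longrightarrow> length zs = n \<Longrightarrow> set_pmf (prod_chan W xs zs) \<subseteq> {ys. length ys = n}"
proof (induction W xs zs arbitrary: n rule: prod_chan.induct)
  case (1 W x xs z zs)
  then show ?case by (cases n) fastforce+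
qed auto

lemma pmf_prod_chan:
  "length xs = n \<Longrightarrow> length zs = n \<Longrightarrow> length ys = n \<Longrightarrow>
    pmf (prod_chan W xs zs) ys = (\<Prod>i<n. pmf (W (xs ! i) (zs ! i)) (ys ! i))"
proof (induction n arbitrary: xs zs ys)
  case (Suc n)
  then obtain x xs' z zs' y ys' where "xs = x # xs'" "zs = z # zs'" "ys = y # ys'"
    "length xs' = n" "length zs' = n" "length ys' = n"
    by (cases xs; cases zs; cases ys) auto
  with Suc.IH[of xs' zs' ys'] show ?case
    by (simp add: pmf_bind_map_Cons prod.lessThan_Suc_shift del: prod.lessThan_Suc)
qed simp

text \<open>Codes take the source and the side information as two lists, and the one-shot result
  wants a pair; this is the i.i.d. source in that shape.\<close>

definition unzip_pmf :: "nat \<Rightarrow> ('x \<times> 'z) pmf \<Rightarrow> ('x list \<times> 'z list) pmf" where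
  "unzip_pmf n P = map_pmf (\<lambda>l. (map fst l, map snd l)) (iid_pmf n P)"

text \<open>Memorylessness: the block source through the block channel is, up to transposition, an
  i.i.d. list of single-letter triples. This makes Chebyshev's inequality available for the
  block.\<close>

lemma chan_joint_unzip_pmf:
  "chan_joint (unzip_pmf n P) (prod_chan W) =
     map_pmf (\<lambda>l. (map fst l, map (\<lambda>t. fst (snd t)) l, map (\<lambda>t. snd (snd t)) l)) (iid_pmf n (chan_joint P W))"
proof (induction n)
  case 0
  then show ?case by (simp add: chan_joint_def unzip_pmf_def bind_return_pmf)
next
  case (Suc n)
  have "chan_joint (unzip_pmf (Suc n) P) (prod_chan W) =
    bind_pmf P (\<lambda>t. bind_pmf (iid_pmf n P) (\<lambda>l. bind_pmf (W (fst t) (snd t)) (\<lambda>y.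
      map_pmf (\<lambda>ys. (fst t # map fst l, y # ys, snd t # map snd l)) (prod_chan W (map fst l) (map snd l)))))"
    by (simp add: chan_joint_def unzip_pmf_def bind_assoc_pmf bind_map_pmf map_bind_pmf map_pmf_comp)
  also have "\<dots> = bind_pmf P (\<lambda>t. bind_pmf (W (fst t) (snd t)) (\<lambda>y. bind_pmf (iid_pmf n P) (\<lambda>l.
      map_pmf (\<lambda>ys. (fst t # map fst l, y # ys, snd t # map snd l)) (prod_chan W (map fst l) (map snd l)))))"
    by (intro bind_pmf_cong refl bind_commute_pmf)
  also have "\<dots> = bind_pmf P (\<lambda>t. bind_pmf (W (fst t) (snd t)) (\<lambda>y.
      map_pmf (\<lambda>(xs, ys, zs). (fst t # xs, y # ys, snd t # zs)) (chan_joint (unzip_pmf n P) (prod_chan W))))"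
    by (simp add: chan_joint_def unzip_pmf_def bind_map_pmf map_bind_pmf map_pmf_comp)
  also have "\<dots> = map_pmf (\<lambda>l. (map fst l, map (\<lambda>t. fst (snd t)) l, map (\<lambda>t. snd (snd t)) l)) (iid_pmf (Suc n) (chan_joint P W))"
    unfolding Suc.IH
    by (simp add: chan_joint_def bind_assoc_pmf bind_map_pmf map_bind_pmf map_pmf_comp case_prod_unfold)
  finally show ?case .
qed

lemma pmf_chan_joint: "pmf (chan_joint P W) (x, y, z) = pmf P (x, z) * pmf (W x z) y"
  using pmf_bind_map_inj[of "\<lambda>t y. (fst t, y, snd t)" P "\<lambda>t. W (fst t) (snd t)" "(x, z)" y]
  by (simp add: chan_joint_def case_prod_unfold prod_eq_iff conj_ac)

lemma chan_joint_source: "map_pmf (\<lambda>(x, y, z). (x, z)) (chan_joint P W) = P"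
  by (simp add: chan_joint_def map_bind_pmf map_pmf_comp case_prod_unfold bind_return_pmf')

lemma chan_joint_z: "map_pmf (\<lambda>t. snd (snd t)) (chan_joint P W) = map_pmf snd P"
  using arg_cong[OF chan_joint_source[of P W], of "map_pmf snd"]
  by (simp add: map_pmf_comp case_prod_unfold)

lemma pmf_unzip_pmf:
  assumes "length xs = n" "length zs = n"
  shows "pmf (unzip_pmf n P) (xs, zs) = (\<Prod>i<n. pmf P (xs ! i, zs ! i))"
proof -
  let ?h = "\<lambda>l. (map fst l, map snd l)"
  have "inj ?h" by (rule inj_on_inverseI[of _ "\<lambda>(xs, zs). zip xs zs"]) (simp add: zip_map_fst_snd)
  then have "pmf (unzip_pmf n P) (?h (zip xs zs)) = pmf (iid_pmf n P) (zip xs zs)"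
    unfolding unzip_pmf_def by (rule pmf_map_inj')
  then show ?thesis using assms by (simp add: pmf_iid_pmf)
qed

text \<open>On the support the mass of \<open>(x, z)\<close> cancels from the information density,
  leaving \<open>log 2 (r t)\<close>. The event thus says that a sum of i.i.d. densities exceeds its
  mean by \<open>n * e\<close>.\<close>

lemma atypical_prob_le:
  fixes P :: "('x::finite \<times> 'z::finite) pmf" and W :: "'x \<Rightarrow> 'z \<Rightarrow> 'y::finite pmf" and n :: nat
  defines "J \<equiv> chan_joint P W" and "Jn \<equiv> chan_joint (unzip_pmf n P) (prod_chan W)"
  assumes n: "0 < n" and e: "0 < e"
  shows "measure_pmf.prob Jn {(xs, ys, zs). 2 powr (real n * (cond_MI J + e)) * pmf (map_pmf snd Jn) (ys, zs)
      < pmf (prod_chan W xs zs) ys * pmf (map_pmf snd (unzip_pmf n P)) zs}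
    \<le> measure_pmf.expectation J (\<lambda>t. (info_density J t - cond_MI J)\<^sup>2) / e\<^sup>2 / n"
proof -
  define U where "U = (\<lambda>l::('x \<times> 'y \<times> 'z) list. (map fst l, map (\<lambda>t. fst (snd t)) l, map (\<lambda>t. snd (snd t)) l))"
  have Jn: "Jn = map_pmf U (iid_pmf n J)"
    unfolding Jn_def J_def U_def by (rule chan_joint_unzip_pmf)
  have sndJn: "map_pmf snd Jn = unzip_pmf n (map_pmf snd J)"
    unfolding Jn unzip_pmf_def by (simp add: U_def map_pmf_comp iid_pmf_map o_def)
  have sndP: "map_pmf snd (unzip_pmf n P) = iid_pmf n (map_pmf snd P)"
    unfolding unzip_pmf_def by (simp add: map_pmf_comp iid_pmf_map)
  let ?T = "2 powr (real n * (cond_MI J + e))"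
  let ?bad = "{(xs, ys, zs). ?T * pmf (map_pmf snd Jn) (ys, zs)
      < pmf (prod_chan W xs zs) ys * pmf (map_pmf snd (unzip_pmf n P)) zs}"
  define r where "r = (\<lambda>(x, y, z). pmf (W x z) y * pmf (map_pmf snd P) z / pmf (map_pmf snd J) (y, z))"
  have supp: "0 < pmf (map_pmf snd J) (snd t)" "0 < r t" "info_density J t = log 2 (r t)" if "t \<in> set_pmf J" for t
  proof -
    obtain x y z where t: "t = (x, y, z)" by (cases t) auto
    have "0 < pmf J t" using that by (simp add: pmf_positive)
    then have "pmf P (x, z) * pmf (W x z) y > 0" by (simp add: J_def pmf_chan_joint t)
    then have pos: "0 < pmf P (x, z)" "0 < pmf (W x z) y" by (auto simp: zero_less_mult_iff)
    have "(y, z) \<in> set_pmf (map_pmf snd J)" using that t by force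
    then show yz: "0 < pmf (map_pmf snd J) (snd t)" by (simp add: pmf_positive t)
    have "z \<in> set_pmf (map_pmf snd P)" using that t unfolding chan_joint_z[of P W, symmetric] J_def by force
    then have "0 < pmf (map_pmf snd P) z" by (simp add: pmf_positive)
    then show "0 < r t" using pos yz by (simp add: r_def t)
    show "info_density J t = log 2 (r t)"
      using pos by (simp add: info_density_def r_def t J_def chan_joint_z chan_joint_source pmf_chan_joint)
  qed
  have "measure_pmf.prob Jn ?bad = measure_pmf.prob (iid_pmf n J) (U -` ?bad)"
    unfolding Jn by simp
  also have "\<dots> \<le> measure_pmf.prob (iid_pmf n J) {l. real n * e \<le> \<bar>(\<Sum>i<n. info_density J (l ! i)) - real n * cond_MI J\<bar>}"
  proof (rule measure_pmf.finite_measure_mono_AE)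
    show "AE l in measure_pmf (iid_pmf n J). l \<in> U -` ?bad \<longrightarrow>
       l \<in> {l. real n * e \<le> \<bar>(\<Sum>i<n. info_density J (l ! i)) - real n * cond_MI J\<bar>}"
      unfolding AE_measure_pmf_iff
    proof (intro ballI impI)
      fix l assume l: "l \<in> set_pmf (iid_pmf n J)" and b: "l \<in> U -` ?bad"
      have len: "length l = n" using length_iid_pmf[OF l] .
      have lJ: "l ! i \<in> set_pmf J" if "i < n" for i using set_iid_pmf[OF l] len that by auto
      have "?T * (\<Prod>i<n. pmf (map_pmf snd J) (snd (l ! i)))
        < (\<Prod>i<n. pmf (W (fst (l ! i)) (snd (snd (l ! i)))) (fst (snd (l ! i)))) * (\<Prod>i<n. pmf (map_pmf snd P) (snd (snd (l ! i))))"
        using b len by (simp add: U_def sndJn sndP pmf_unzip_pmf pmf_prod_chan[of _ n] pmf_iid_pmf)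
      also have "\<dots> = (\<Prod>i<n. r (l ! i) * pmf (map_pmf snd J) (snd (l ! i)))"
        unfolding prod.distrib[symmetric]
      proof (rule prod.cong[OF refl])
        fix i assume "i \<in> {..<n}"
        then have "0 < pmf (map_pmf snd J) (snd (l ! i))" using supp(1)[OF lJ] by simp
        then show "pmf (W (fst (l ! i)) (snd (snd (l ! i)))) (fst (snd (l ! i))) * pmf (map_pmf snd P) (snd (snd (l ! i)))
           = r (l ! i) * pmf (map_pmf snd J) (snd (l ! i))"
          by (cases "l ! i") (simp add: r_def)
      qed
      also have "\<dots> = (\<Prod>i<n. r (l ! i)) * (\<Prod>i<n. pmf (map_pmf snd J) (snd (l ! i)))" by (rule prod.distrib)
      finally have "?T * (\<Prod>i<n. pmf (map_pmf snd J) (snd (l ! i))) < (\<Prod>i<n. r (l ! i)) * (\<Prod>i<n. pmf (map_pmf snd J) (snd (l ! i)))" .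
      moreover have "0 < (\<Prod>i<n. pmf (map_pmf snd J) (snd (l ! i)))" using supp(1)[OF lJ] by (intro prod_pos) simp
      ultimately have "?T < (\<Prod>i<n. r (l ! i))" by simp
      then have "log 2 ?T < log 2 (\<Prod>i<n. r (l ! i))" by (subst log_less_cancel_iff) (auto intro!: prod_pos supp lJ)
      also have "log 2 (\<Prod>i<n. r (l ! i)) = (\<Sum>i<n. info_density J (l ! i))"
        using supp(2,3)[OF lJ] unfolding log_def by (subst ln_prod) (force simp: sum_divide_distrib log_def)+
      finally have "real n * (cond_MI J + e) < (\<Sum>i<n. info_density J (l ! i))" by simp
      then show "l \<in> {l. real n * e \<le> \<bar>(\<Sum>i<n. info_density J (l ! i)) - real n * cond_MI J\<bar>}"
        by (simp add: algebra_simps)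
    qed
  qed simp
  also have "\<dots> \<le> real n * measure_pmf.expectation J (\<lambda>t. (info_density J t - cond_MI J)\<^sup>2) / (real n * e)\<^sup>2"
    using iid_Chebyshev[of J "real n * e" n "info_density J"] n e unfolding cond_MI_eq by simp
  also have "\<dots> = measure_pmf.expectation J (\<lambda>t. (info_density J t - cond_MI J)\<^sup>2) / e\<^sup>2 / n"
    using n by (simp add: power2_eq_square field_simps)
  finally show ?thesis .
qed

text \<open>Ensures that the exponent of the message set size is nonnegative, so that at least one
  message exists.\<close>

lemma cond_MI_nonneg:
  fixes J :: "('x::finite \<times> 'y::finite \<times> 'z::finite) pmf"
  shows "0 \<le> cond_MI J"
proof -
  interpret information_space "measure_pmf J" 2 by unfold_locales simp
  have [simp]: "(\<lambda>t. fst (snd t)) ` (UNIV :: ('x \<times> 'y \<times> 'z) set) = UNIV"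
    "(\<lambda>t. snd (snd t)) ` (UNIV :: ('x \<times> 'y \<times> 'z) set) = UNIV"
    "(fst :: 'x \<times> 'y \<times> 'z \<Rightarrow> 'x) ` UNIV = UNIV"
    by (auto simp: image_def)
  show ?thesis
    using conditional_mutual_information_nonneg[of fst "\<lambda>t. fst (snd t)" "\<lambda>t. snd (snd t)"]
    by (simp add: cond_MI_def simple_function_def)
qed

text \<open>Rounding the size of an index set down loses at most a factor 2, the source of the inner
  factors 2 in the error terms of the next lemma.\<close>

lemma nat_floor_ge_half:
  assumes "1 \<le> (v::real)"
  shows "0 < nat \<lfloor>v\<rfloor>" "v / 2 \<le> real (nat \<lfloor>v\<rfloor>)"
proof -
  have "1 \<le> \<lfloor>v\<rfloor>" using assms by simp
  then show "0 < nat \<lfloor>v\<rfloor>" by simp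
  have "v - 1 < of_int \<lfloor>v\<rfloor>" by linarith
  moreover have "1 \<le> real_of_int \<lfloor>v\<rfloor>" using \<open>1 \<le> \<lfloor>v\<rfloor>\<close> by simp
  ultimately have "v \<le> 2 * real_of_int \<lfloor>v\<rfloor>" by linarith
  then show "v / 2 \<le> real (nat \<lfloor>v\<rfloor>)" using \<open>1 \<le> \<lfloor>v\<rfloor>\<close> by simp
qed

text \<open>The three error terms are atypicality of the density, exhaustion of the list, and the
  passage to fixed lists. The last is the square root of |X|^(2n) over the number of keys, so any
  key rate above \<open>2 * log 2 CARD('x)\<close> makes it decay.\<close>

lemma ex_simulating_code:
  fixes P :: "('x::finite \<times> 'z::finite) pmf" and W :: "'x \<Rightarrow> 'z \<Rightarrow> 'x pmf" and D :: "'x \<Rightarrow> 'x \<Rightarrow> real"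
  assumes D: "\<And>x y. 0 \<le> D x y \<and> D x y \<le> dmax" and n: "0 < n" and e: "0 < e"
  defines "J \<equiv> chan_joint P W"
  defines "M \<equiv> 2 powr (real n * (cond_MI J + e))" and "M0 \<equiv> 2 powr (real n * (2 * log 2 CARD('x) + e))"
  defines "V \<equiv> measure_pmf.expectation J (\<lambda>t. (info_density J t - cond_MI J)\<^sup>2)"
  shows "\<exists>f g. valid_code n M M0 f g \<and>
    map_pmf (\<lambda>(xs, zs, k, ys). (ys, zs)) (code_joint P n M0 f g) = unzip_pmf n (map_pmf snd J) \<and>
    code_distortion D n (code_joint P n M0 f g) \<le> measure_pmf.expectation J (\<lambda>(x, y, z). D x y)
      + dmax * (2 * (2 * (V / (e / 2)\<^sup>2 / n + 2 * (2 powr (- e / 2)) ^ n) + sqrt (2 * (2 powr (- e)) ^ n)))"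
proof -
  define Pn where "Pn = unzip_pmf n P"
  define Jn where "Jn = chan_joint Pn (prod_chan W)"
  \<comment> \<open>The threshold lies halfway in the slack \<open>e\<close>: half of it is spent on
    typicality, and half makes \<open>T / M\<close> decay exponentially.\<close>
  define T where "T = 2 powr (real n * (cond_MI J + e / 2))"
  define L where "L = {xs::'x list. length xs = n}"
  have T: "0 < T" by (simp add: T_def)
  have "0 \<le> real n * (cond_MI J + e)" using e cond_MI_nonneg[of J] by simp
  then have M1: "1 \<le> M" by (simp add: M_def ge_one_powr_ge_zero)
  have logX: "0 \<le> log 2 (real CARD('x))" by (simp add: Suc_le_eq)
  have "0 \<le> real n * (2 * log 2 CARD('x) + e)" using e logX by simp
  then have M01: "1 \<le> M0" by (simp add: M0_def ge_one_powr_ge_zero)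
  have dmax: "0 \<le> dmax" using D by (meson order_trans)
  have fL: "finite L" unfolding L_def by (rule finite_lists_of_length)
  have suppPn: "length xs = n \<and> length zs = n" if "(xs, zs) \<in> set_pmf Pn" for xs zs
    using that by (auto simp: Pn_def unzip_pmf_def dest: length_iid_pmf)
  define bad where "bad = {(xs, ys, zs). T * pmf (map_pmf snd Jn) (ys, zs) < pmf (prod_chan W xs zs) ys * pmf (map_pmf snd Pn) zs}"
  define \<delta> where "\<delta> = 2 * (measure_pmf.prob Jn bad + T / nat \<lfloor>M\<rfloor>) + sqrt (card L * card L / nat \<lfloor>M0\<rfloor>)"
  define J' where "J' f g = bind_pmf Pn (\<lambda>(x, z). bind_pmf (pmf_of_set {1..nat \<lfloor>M0\<rfloor>}) (\<lambda>k. bind_pmf (f x z k) (\<lambda>m.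
                 map_pmf (\<lambda>y. (x, y, z)) (g m z k))))"
    for f :: "'x list \<Rightarrow> 'z list \<Rightarrow> nat \<Rightarrow> nat pmf" and g :: "nat \<Rightarrow> 'z list \<Rightarrow> nat \<Rightarrow> 'x list pmf"
  have finPn: "finite (set_pmf Pn)" by (simp add: Pn_def unzip_pmf_def finite_set_iid_pmf)
  have PnL: "fst ` set_pmf Pn \<subseteq> L" using suppPn by (auto simp: L_def)
  have WL: "set_pmf (prod_chan W x z) \<subseteq> L" if "(x, z) \<in> set_pmf Pn" for x z
    unfolding L_def using suppPn[OF that] by (intro length_prod_chan) auto
  have "\<exists>f g. (\<forall>x z k. set_pmf (f x z k) \<subseteq> {1..nat \<lfloor>M\<rfloor>}) \<and> (\<forall>m\<in>{1..nat \<lfloor>M\<rfloor>}. \<forall>z k. set_pmf (g m z k) \<subseteq> L) \<and>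
      (let J' = J' f g in map_pmf snd J' = map_pmf snd Jn \<and> (\<forall>d c. (\<forall>t. 0 \<le> d t \<and> d t \<le> c) \<longrightarrow>
        measure_pmf.expectation J' d \<le> measure_pmf.expectation Jn d + c * (2 * \<delta>)))"
    unfolding \<delta>_def bad_def Jn_def J'_def
    by (rule one_shot_simulation_side_info[OF finPn fL PnL fL WL T nat_floor_ge_half(1)[OF M1] nat_floor_ge_half(1)[OF M01]])
  then obtain f g where f: "\<And>x z k. set_pmf (f x z k) \<subseteq> {1..nat \<lfloor>M\<rfloor>}"
    and g: "\<And>m z k. m \<in> {1..nat \<lfloor>M\<rfloor>} \<Longrightarrow> set_pmf (g m z k) \<subseteq> L"
    and snd: "map_pmf snd (J' f g) = map_pmf snd Jn"
    and dist: "\<And>d c. (\<forall>t. 0 \<le> d t \<and> d t \<le> c) \<Longrightarrow> measure_pmf.expectation (J' f g) d \<le> measure_pmf.expectation Jn d + c * (2 * \<delta>)"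
    unfolding Let_def by blast
  have code: "valid_code n M M0 f g"
    unfolding valid_code_def idx_def
  proof (intro conjI allI impI ballI)
    show "{1..nat \<lfloor>M0\<rfloor>} \<noteq> {}" using M01 by (simp add: le_nat_iff le_floor_iff)
    show "set_pmf (f xs zs k) \<subseteq> {1..nat \<lfloor>M\<rfloor>}" for xs zs k by (rule f)
    show "length ys = n" if "m \<in> {1..nat \<lfloor>M\<rfloor>} \<and> length zs = n \<and> k \<in> {1..nat \<lfloor>M0\<rfloor>}" "ys \<in> set_pmf (g m zs k)" for m zs k ys
      using g[of m zs k] that by (auto simp: L_def)
  qed
  define C where "C = code_joint P n M0 f g"
  have C: "map_pmf (\<lambda>(xs, zs, k, ys). (xs, ys, zs)) C = J' f g"
    by (simp add: C_def code_joint_def J'_def Pn_def unzip_pmf_def idx_def bind_map_pmf map_bind_pmf map_pmf_comp)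
  have Jn: "Jn = map_pmf (\<lambda>l. (map fst l, map (\<lambda>t. fst (snd t)) l, map (\<lambda>t. snd (snd t)) l)) (iid_pmf n J)"
    unfolding Jn_def Pn_def J_def by (rule chan_joint_unzip_pmf)
  have "map_pmf (\<lambda>(xs, zs, k, ys). (ys, zs)) C = map_pmf snd (map_pmf (\<lambda>(xs, zs, k, ys). (xs, ys, zs)) C)"
    by (simp add: map_pmf_comp case_prod_unfold)
  also have "\<dots> = unzip_pmf n (map_pmf snd J)"
    unfolding C snd Jn unzip_pmf_def by (simp add: map_pmf_comp iid_pmf_map o_def)
  finally have yz: "map_pmf (\<lambda>(xs, zs, k, ys). (ys, zs)) C = unzip_pmf n (map_pmf snd J)" .
  define d where "d = (\<lambda>(xs, ys, zs::'z list). (1 / real n) * (\<Sum>i<n. D (xs ! i) (ys ! i)))"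
  have d: "\<forall>t. 0 \<le> d t \<and> d t \<le> dmax"
  proof
    fix t :: "'x list \<times> 'x list \<times> 'z list"
    obtain xs ys zs where t: "t = (xs, ys, zs)" by (cases t) auto
    have "(\<Sum>i<n. D (xs ! i) (ys ! i)) \<le> real n * dmax" using D sum_bounded_above[of "{..<n}" "\<lambda>i. D (xs ! i) (ys ! i)" dmax] by simp
    moreover have "0 \<le> (\<Sum>i<n. D (xs ! i) (ys ! i))" using D by (intro sum_nonneg) auto
    ultimately show "0 \<le> d t \<and> d t \<le> dmax" using n by (simp add: d_def t field_simps)
  qed
  have "code_distortion D n C = measure_pmf.expectation (map_pmf (\<lambda>(xs, zs, k, ys). (xs, ys, zs)) C) d"
    by (simp add: code_distortion_def d_def case_prod_unfold)
  also have "\<dots> \<le> measure_pmf.expectation Jn d + dmax * (2 * \<delta>)"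
    unfolding C by (rule dist[OF d])
  also have "measure_pmf.expectation Jn d = measure_pmf.expectation J (\<lambda>(x, y, z). D x y)"
  proof -
    have fI: "finite (set_pmf (iid_pmf n J))" by (simp add: finite_set_iid_pmf)
    have "measure_pmf.expectation Jn d = measure_pmf.expectation (iid_pmf n J) (\<lambda>l. (1 / real n) * (\<Sum>i<n. D (map fst l ! i) (map (\<lambda>t. fst (snd t)) l ! i)))"
      unfolding Jn by (simp add: d_def)
    also have "\<dots> = measure_pmf.expectation (iid_pmf n J) (\<lambda>l. (1 / real n) * (\<Sum>i<n. (\<lambda>(x, y, z). D x y) (l ! i)))"
      by (intro expectation_cong_pmf) (auto dest!: length_iid_pmf simp: case_prod_unfold intro!: sum.cong)
    also have "\<dots> = (1 / real n) * (\<Sum>i<n. measure_pmf.expectation (iid_pmf n J) (\<lambda>l. (\<lambda>(x, y, z). D x y) (l ! i)))"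
      using fI by (simp add: Bochner_Integration.integral_sum integrable_measure_pmf_finite)
    also have "\<dots> = (1 / real n) * (\<Sum>i<n. measure_pmf.expectation (map_pmf (\<lambda>l. l ! i) (iid_pmf n J)) (\<lambda>(x, y, z). D x y))"
      by simp
    also have "\<dots> = measure_pmf.expectation J (\<lambda>(x, y, z). D x y)"
      using n by (simp add: map_nth_iid_pmf del: integral_map_pmf)
    finally show ?thesis .
  qed
  also have "\<delta> \<le> 2 * (V / (e / 2)\<^sup>2 / n + 2 * (2 powr (- e / 2)) ^ n) + sqrt (2 * (2 powr (- e)) ^ n)"
  proof -
    have "measure_pmf.prob Jn bad \<le> V / (e / 2)\<^sup>2 / n"
      unfolding bad_def Jn_def Pn_def T_def V_def J_def using n e by (intro atypical_prob_le) auto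
    moreover have "T / nat \<lfloor>M\<rfloor> \<le> 2 * (2 powr (- e / 2)) ^ n"
    proof -
      have "T / nat \<lfloor>M\<rfloor> \<le> T / (M / 2)"
        using nat_floor_ge_half[OF M1] T M1 by (intro divide_left_mono) auto
      also have "\<dots> = 2 * (T / M)" by simp
      also have "T / M = 2 powr (real n * (- e / 2))"
        by (simp add: T_def M_def powr_diff[symmetric] algebra_simps)
      also have "\<dots> = (2 powr (- e / 2)) ^ n" by (simp add: powr_realpow[symmetric] powr_powr mult.commute)
      finally show ?thesis .
    qed
    moreover have "sqrt (card L * card L / nat \<lfloor>M0\<rfloor>) \<le> sqrt (2 * (2 powr (- e)) ^ n)"
    proof (rule real_sqrt_le_mono)
      have cL: "real (card L) = 2 powr (real n * log 2 CARD('x))"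
      proof -
        have "2 powr (real n * log 2 CARD('x)) = (2 powr (log 2 CARD('x))) ^ n"
          by (subst mult.commute, subst powr_powr[symmetric], subst powr_realpow) auto
        then show ?thesis by (simp add: L_def card_lists_of_length)
      qed
      have "real (card L * card L) / nat \<lfloor>M0\<rfloor> \<le> real (card L * card L) / (M0 / 2)"
        using nat_floor_ge_half[OF M01] M01 by (intro divide_left_mono) auto
      also have "\<dots> = 2 * (real (card L) * real (card L) / M0)" by simp
      also have "real (card L) * real (card L) / M0 = 2 powr (real n * (- e))"
        by (simp add: cL M0_def powr_diff[symmetric] powr_add[symmetric] algebra_simps)
      also have "\<dots> = (2 powr (- e)) ^ n" by (simp add: powr_realpow[symmetric] powr_powr mult.commute)
      finally show "real (card L * card L) / nat \<lfloor>M0\<rfloor> \<le> 2 * (2 powr (- e)) ^ n" .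
    qed
    ultimately show ?thesis unfolding \<delta>_def by (intro add_mono mult_left_mono) simp_all
  qed
  finally have "code_distortion D n C \<le> measure_pmf.expectation J (\<lambda>(x, y, z). D x y)
      + dmax * (2 * (2 * (V / (e / 2)\<^sup>2 / n + 2 * (2 powr (- e / 2)) ^ n) + sqrt (2 * (2 powr (- e)) ^ n)))"
    using dmax by (simp add: mult_left_mono)
  with code yz show ?thesis unfolding C_def by blast
qed

subsection \<open>Achievability and converse\<close>

text \<open>Either \<open>c\<close> is at least 1 and nothing is claimed, or distances stay below 1
  along all large n. The latter forces \<open>p = q\<close>, and all distances vanish.\<close>

lemma tv_dist_iid_le_of_limsup:
  fixes p q :: "'a::finite pmf"
  assumes lim: "limsup (\<lambda>n. ereal (tv_dist (iid_pmf n p) (iid_pmf n q))) \<le> ereal c"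
  shows "tv_dist (iid_pmf n p) (iid_pmf n q) \<le> c"
proof (cases "1 \<le> c")
  case True
  then show ?thesis using tv_dist_le_1 order_trans by blast
next
  case False
  \<comment> \<open>Any value strictly between \<open>c\<close> and 1 serves; it keeps the distances
    uniformly away from 1.\<close>
  define c' where "c' = (c + 1) / 2"
  have c': "c < c'" "c' < 1" using False by (auto simp: c'_def)
  have "limsup (\<lambda>n. ereal (tv_dist (iid_pmf n p) (iid_pmf n q))) < ereal c'"
    using lim c' by (simp add: le_less_trans)
  then have "\<forall>\<^sub>F n in sequentially. ereal (tv_dist (iid_pmf n p) (iid_pmf n q)) < ereal c'"
    by (rule Limsup_lessD)
  then obtain n0 where n0: "\<And>n. n0 \<le> n \<Longrightarrow> tv_dist (iid_pmf n p) (iid_pmf n q) < c'"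
    by (auto simp: eventually_sequentially)
  have "p = q"
  proof (rule pmf_eqI, rule ccontr)
    fix a assume ne: "pmf p a \<noteq> pmf q a"
    define d where "d = (pmf p a - pmf q a)\<^sup>2"
    have d: "0 < (1 - c') * d" using ne c' by (simp add: d_def)
    obtain n1 where n1: "8 / ((1 - c') * d) < real n1" using reals_Archimedean2 by blast
    define m where "m = max n0 n1"
    have "8 < (1 - c') * d * real n1" using n1 d by (simp add: field_simps)
    also have "\<dots> \<le> (1 - c') * d * real m" using d by (intro mult_left_mono) (auto simp: m_def)
    also have "\<dots> = (1 - c') * (real m * d)" by simp
    also have "\<dots> \<le> (1 - tv_dist (iid_pmf m p) (iid_pmf m q)) * (real m * d)"
      using n0[of m] by (intro mult_right_mono) (auto simp: m_def d_def)
    also have "\<dots> \<le> 8" unfolding d_def by (rule tv_dist_iid_ge)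
    finally show False by simp
  qed
  then have "limsup (\<lambda>n. ereal (tv_dist (iid_pmf n p) (iid_pmf n q))) = 0"
    by (simp add: tv_dist_self Limsup_const flip: zero_ereal_def)
  with lim have "0 \<le> c" by (simp add: zero_ereal_def)
  with \<open>p = q\<close> show ?thesis by (simp add: tv_dist_self)
qed

lemma achievable_strong_cond_MI:
  fixes P :: "('x::finite \<times> 'z::finite) pmf" and W :: "'x \<Rightarrow> 'z \<Rightarrow> 'x pmf" and D :: "'x \<Rightarrow> 'x \<Rightarrow> real"
  assumes D: "\<And>x y. 0 \<le> D x y \<and> D x y \<le> dmax"
    and ED: "measure_pmf.expectation (chan_joint P W) (\<lambda>(x, y, z). D x y) \<le> Dc"
    and tv: "\<And>n. tv_dist (iid_pmf n (map_pmf fst P)) (iid_pmf n (map_pmf (\<lambda>t. fst (snd t)) (chan_joint P W))) \<le> Pc"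
  shows "achievable_strong YZ_iid P D (cond_MI (chan_joint P W)) (2 * log 2 CARD('x)) Dc Pc"
  unfolding achievable_strong_def Let_def
proof (intro allI impI)
  fix e :: real assume e: "0 < e"
  define J where "J = chan_joint P W"
  define V where "V = measure_pmf.expectation J (\<lambda>t. (info_density J t - cond_MI J)\<^sup>2)"
  define err where "err n = dmax * (2 * (2 * (V / (e / 2)\<^sup>2 / real n + 2 * (2 powr (- e / 2)) ^ n) + sqrt (2 * (2 powr (- e)) ^ n)))" for n
  have pw: "2 powr (- e / 2) < 1" "2 powr (- e) < 1" using e powr_less_mono[of "- e / 2" 0 2] powr_less_mono[of "- e" 0 2] by auto
  \<comment> \<open>\<open>V\<close> is a single-letter variance and \<open>dmax\<close> a constant,
    so each summand tends to 0 as n grows.\<close>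
  have "err \<longlonglongrightarrow> dmax * (2 * (2 * (0 + 2 * 0) + sqrt (2 * 0)))"
    unfolding err_def using pw
    by (intro tendsto_intros LIMSEQ_realpow_zero tendsto_divide_0[OF tendsto_const] filterlim_at_top_imp_at_infinity filterlim_real_sequentially) auto
  then have "\<forall>\<^sub>F n in sequentially. err n < e" using e by (intro order_tendstoD(2)[of err 0]) auto
  then show "\<forall>\<^sub>F n in sequentially. \<exists>f g. valid_code n (2 powr (real n * (cond_MI (chan_joint P W) + e))) (2 powr (real n * (2 * log 2 (real CARD('x)) + e))) f g \<and>
     YZ_iid n (code_joint P n (2 powr (real n * (2 * log 2 (real CARD('x)) + e))) f g) \<and>
     code_distortion D n (code_joint P n (2 powr (real n * (2 * log 2 (real CARD('x)) + e))) f g) \<le> Dc + e \<and>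
     tv_dist (map_pmf (\<lambda>(xs, zs, k, ys). xs) (code_joint P n (2 powr (real n * (2 * log 2 (real CARD('x)) + e))) f g))
       (map_pmf (\<lambda>(xs, zs, k, ys). ys) (code_joint P n (2 powr (real n * (2 * log 2 (real CARD('x)) + e))) f g)) \<le> Pc + e"
    using eventually_gt_at_top[of 0]
  proof eventually_elim
    case (elim n)
    define M0 where "M0 = 2 powr (real n * (2 * log 2 (real CARD('x)) + e))"
    obtain f g where code: "valid_code n (2 powr (real n * (cond_MI J + e))) M0 f g"
      and yz: "map_pmf (\<lambda>(xs, zs, k, ys). (ys, zs)) (code_joint P n M0 f g) = unzip_pmf n (map_pmf snd J)"
      and dist: "code_distortion D n (code_joint P n M0 f g) \<le> measure_pmf.expectation J (\<lambda>(x, y, z). D x y) + err n"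
      using ex_simulating_code[of D dmax n e P W, OF D elim(2) e] unfolding J_def M0_def err_def V_def by blast
    let ?C = "code_joint P n M0 f g"
    have "map_pmf (\<lambda>(xs, zs, k, ys). zip ys zs) ?C = map_pmf (\<lambda>(ys, zs). zip ys zs) (map_pmf (\<lambda>(xs, zs, k, ys). (ys, zs)) ?C)"
      by (simp add: map_pmf_comp case_prod_unfold)
    also have "\<dots> = iid_pmf n (map_pmf snd J)"
      unfolding yz unzip_pmf_def by (simp add: map_pmf_comp zip_map_fst_snd)
    finally have YZ: "YZ_iid n ?C" unfolding YZ_iid_def by blast
    have "map_pmf (\<lambda>(xs, zs, k, ys). ys) ?C = map_pmf fst (map_pmf (\<lambda>(xs, zs, k, ys). (ys, zs)) ?C)"
      by (simp add: map_pmf_comp case_prod_unfold)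
    also have "\<dots> = iid_pmf n (map_pmf (\<lambda>t. fst (snd t)) J)"
      unfolding yz unzip_pmf_def by (simp add: map_pmf_comp iid_pmf_map o_def)
    finally have Y: "map_pmf (\<lambda>(xs, zs, k, ys). ys) ?C = iid_pmf n (map_pmf (\<lambda>t. fst (snd t)) J)" .
    have X: "map_pmf (\<lambda>(xs, zs, k, ys). xs) ?C = iid_pmf n (map_pmf fst P)"
      using map_code_joint_source[of "\<lambda>xs zs. xs" P n M0 f g] by (simp add: iid_pmf_map)
    have "tv_dist (map_pmf (\<lambda>(xs, zs, k, ys). xs) ?C) (map_pmf (\<lambda>(xs, zs, k, ys). ys) ?C) \<le> Pc + e"
      unfolding X Y J_def using tv[of n] e by linarith
    moreover have "code_distortion D n ?C \<le> Dc + e" using dist ED elim by (simp add: J_def)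
    ultimately show ?case using code YZ unfolding J_def M0_def by blast
  qed
qed

section \<open>Limits of laws on finite alphabets\<close>

lemma abs_mult_ln_le:
  assumes "0 \<le> (x::real)" "x \<le> 1"
  shows "x * \<bar>ln x\<bar> \<le> 2 * sqrt x"
proof (cases "x = 0")
  case False
  define s where "s = sqrt x"
  have s: "0 < s" "s \<le> 1" "x = s * s" using False assms by (auto simp: s_def)
  have "ln (1 / s) \<le> 1 / s" using s by (intro less_imp_le ln_less_self) auto
  then have "- ln s \<le> 1 / s" using s by (simp add: ln_div)
  then have "s * (- ln s) \<le> 1" using s by (simp add: field_simps)
  have "x * \<bar>ln x\<bar> = 2 * s * (s * (- ln s))" using s by (simp add: ln_mult)
  also have "\<dots> \<le> 2 * s * 1" using \<open>s * (- ln s) \<le> 1\<close> s by (intro mult_left_mono) auto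
  finally show ?thesis by (simp add: s_def)
qed simp

text \<open>The delicate case is \<open>b\<close> tending to 0, where \<open>ln (b j)\<close> may be
  unbounded. Domination of \<open>a\<close> by \<open>b\<close> leaves
  \<open>b * \<bar>ln b\<bar>\<close>, which the square root controls; the limit agrees with the
  value 0 of \<open>a' * ln b'\<close>.\<close>

lemma tendsto_mult_ln:
  fixes a b :: "nat \<Rightarrow> real"
  assumes ab: "\<And>j. 0 \<le> a j \<and> a j \<le> b j \<and> b j \<le> 1" and a: "a \<longlonglongrightarrow> a'" and b: "b \<longlonglongrightarrow> b'"
  shows "(\<lambda>j. a j * ln (b j)) \<longlonglongrightarrow> a' * ln b'"
proof (cases "b' = 0")
  case False
  then show ?thesis using a b by (intro tendsto_mult tendsto_ln)
next
  case True
  have "(\<lambda>j. 2 * sqrt (b j)) \<longlonglongrightarrow> 2 * sqrt b'" by (intro tendsto_intros b)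
  then have "(\<lambda>j. 2 * sqrt (b j)) \<longlonglongrightarrow> 0" using True by simp
  then have "(\<lambda>j. a j * ln (b j)) \<longlonglongrightarrow> 0"
  proof (rule Lim_null_comparison[rotated], intro always_eventually allI)
    fix j
    have "norm (a j * ln (b j)) = a j * \<bar>ln (b j)\<bar>" using ab[of j] by (simp add: abs_mult)
    also have "\<dots> \<le> b j * \<bar>ln (b j)\<bar>" using ab[of j] by (intro mult_right_mono) auto
    also have "\<dots> \<le> 2 * sqrt (b j)" using ab[of j] by (intro abs_mult_ln_le) auto
    finally show "norm (a j * ln (b j)) \<le> 2 * sqrt (b j)" .
  qed
  then show ?thesis using True by simp
qed

lemma pmf_map_finite:
  fixes p :: "'a::finite pmf"
  shows "pmf (map_pmf h p) a = (\<Sum>t\<in>h -` {a}. pmf p t)"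
  by (simp add: pmf_map measure_measure_pmf_finite)

lemma pmf_le_map: "pmf p t \<le> pmf (map_pmf h p) (h t)"
proof -
  have "pmf p t = measure_pmf.prob p {t}" by (simp add: pmf.rep_eq)
  also have "\<dots> \<le> measure_pmf.prob p (h -` {h t})" by (intro measure_pmf.finite_measure_mono) auto
  finally show ?thesis by (simp add: pmf_map)
qed

text \<open>The density may diverge at a point whose mass vanishes in the limit. Splitting the
  logarithm into four gives terms in which the joint mass multiplies the logarithm of itself or of a
  marginal that dominates it, and each of these converges.\<close>

lemma cond_MI_tendsto:
  fixes Q :: "nat \<Rightarrow> ('x::finite \<times> 'y::finite \<times> 'z::finite) pmf"
  assumes lim: "\<And>t. (\<lambda>j. pmf (Q j) t) \<longlonglongrightarrow> pmf Q' t"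
  shows "(\<lambda>j. cond_MI (Q j)) \<longlonglongrightarrow> cond_MI Q'"
proof -
  define xz where "xz = (\<lambda>(x::'x, y::'y, z::'z). (x, z))"
  define zz where "zz = (\<lambda>t::'x \<times> 'y \<times> 'z. snd (snd t))"
  have limm: "(\<lambda>j. pmf (map_pmf h (Q j)) a) \<longlonglongrightarrow> pmf (map_pmf h Q') a" for h :: "_ \<Rightarrow> 'b" and a
    unfolding pmf_map_finite by (intro tendsto_sum lim)
  have eq: "cond_MI R = (\<Sum>t\<in>UNIV. (pmf R t * ln (pmf R t) + pmf R t * ln (pmf (map_pmf zz R) (zz t))
      - pmf R t * ln (pmf (map_pmf xz R) (xz t)) - pmf R t * ln (pmf (map_pmf snd R) (snd t))) / ln 2)"
    for R :: "('x \<times> 'y \<times> 'z) pmf"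
  proof -
    have "cond_MI R = (\<Sum>t\<in>UNIV. info_density R t * pmf R t)"
      unfolding cond_MI_eq by (intro integral_measure_pmf_real) auto
    also have "\<dots> = (\<Sum>t\<in>UNIV. (pmf R t * ln (pmf R t) + pmf R t * ln (pmf (map_pmf zz R) (zz t))
      - pmf R t * ln (pmf (map_pmf xz R) (xz t)) - pmf R t * ln (pmf (map_pmf snd R) (snd t))) / ln 2)"
    proof (rule sum.cong[OF refl])
      fix t :: "'x \<times> 'y \<times> 'z"
      show "info_density R t * pmf R t = (pmf R t * ln (pmf R t) + pmf R t * ln (pmf (map_pmf zz R) (zz t))
        - pmf R t * ln (pmf (map_pmf xz R) (xz t)) - pmf R t * ln (pmf (map_pmf snd R) (snd t))) / ln 2"
      proof (cases "pmf R t = 0")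
        case False
        then have p: "0 < pmf R t" by (simp add: pmf_pos)
        have m: "0 < pmf (map_pmf zz R) (zz t)" "0 < pmf (map_pmf xz R) (xz t)" "0 < pmf (map_pmf snd R) (snd t)"
          using p pmf_le_map less_le_trans by metis+
        have "info_density R t = log 2 (pmf R t * pmf (map_pmf zz R) (zz t) / (pmf (map_pmf xz R) (xz t) * pmf (map_pmf snd R) (snd t)))"
          by (cases t) (simp add: info_density_def xz_def zz_def)
        also have "\<dots> = (ln (pmf R t) + ln (pmf (map_pmf zz R) (zz t)) - ln (pmf (map_pmf xz R) (xz t)) - ln (pmf (map_pmf snd R) (snd t))) / ln 2"
          using p m by (simp add: log_def ln_div ln_mult)
        finally show ?thesis by (simp add: algebra_simps)
      qed simp
    qed
    finally show ?thesis .
  qed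
  show ?thesis
    unfolding eq
    by (intro tendsto_sum tendsto_divide tendsto_const tendsto_add tendsto_diff tendsto_mult_ln lim limm)
       (auto simp: pmf_le_1 pmf_le_map)
qed

text \<open>Compactness of the unit cube; no mass escapes in the limit because the alphabet is
  finite.\<close>

lemma pmf_convergent_subsequence:
  fixes Q :: "nat \<Rightarrow> 'a::finite pmf"
  shows "\<exists>Q' r. strict_mono (r :: nat \<Rightarrow> nat) \<and> (\<forall>t. (\<lambda>j. pmf (Q (r j)) t) \<longlonglongrightarrow> pmf Q' t)"
proof -
  define v :: "nat \<Rightarrow> real ^ 'a" where "v j = (\<chi> t. pmf (Q j) t)" for j
  have "\<forall>j. v j \<in> cbox 0 1" by (simp add: v_def mem_box_cart pmf_le_1)
  then obtain l r where r: "strict_mono (r :: nat \<Rightarrow> nat)" and l: "(v \<circ> r) \<longlonglongrightarrow> l"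
    using compact_imp_seq_compact[OF compact_cbox[of "0 :: real ^ 'a" 1]] unfolding seq_compact_def by metis
  have lt: "(\<lambda>j. pmf (Q (r j)) t) \<longlonglongrightarrow> l $ t" for t
    using tendsto_vec_nth[OF l, of t] by (simp add: v_def o_def)
  have nonneg: "0 \<le> l $ t" for t by (rule LIMSEQ_le_const[OF lt]) simp
  have "(\<lambda>j. \<Sum>t\<in>UNIV. pmf (Q (r j)) t) \<longlonglongrightarrow> (\<Sum>t\<in>UNIV. l $ t)" by (intro tendsto_sum lt)
  then have sum: "(\<Sum>t\<in>UNIV. l $ t) = 1" by (simp add: sum_pmf_eq_1 LIMSEQ_const_iff)
  have "pmf (embed_pmf (\<lambda>t. l $ t)) t = l $ t" for t
  proof (rule pmf_embed_pmf)
    show "(\<integral>\<^sup>+x. ennreal (l $ x) \<partial>count_space UNIV) = 1"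
      using nonneg sum by (simp add: nn_integral_count_space_finite)
  qed (rule nonneg)
  with lt r show ?thesis by (intro exI[of _ "embed_pmf (\<lambda>t. l $ t)"] exI[of _ r]) simp
qed

text \<open>Turns a limiting joint law into an admissible channel: disintegration with the pair
  \<open>(x, z)\<close> as the conditioning coordinate.\<close>

lemma ex_channel:
  assumes "map_pmf (\<lambda>(x, y, z). (x, z)) Q = P"
  shows "\<exists>W. chan_joint P W = Q"
proof -
  define Q2 where "Q2 = map_pmf (\<lambda>(x, y, z). (y, (x, z))) Q"
  have P: "map_pmf snd Q2 = P" using assms by (simp add: Q2_def map_pmf_comp case_prod_unfold)
  obtain K where K: "Q2 = bind_pmf (map_pmf snd Q2) (\<lambda>z. map_pmf (\<lambda>x. (x, z)) (K z))"
    using disintegrate_snd[of Q2] by blast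
  have "Q = map_pmf (\<lambda>(y, x, z). (x, y, z)) Q2"
    by (simp add: Q2_def map_pmf_comp case_prod_unfold)
  also have "\<dots> = chan_joint P (\<lambda>x z. K (x, z))"
    by (subst K) (simp add: P chan_joint_def map_bind_pmf map_pmf_comp case_prod_unfold)
  finally show ?thesis by blast
qed

text \<open>The i.i.d. restriction makes the law of the output block the n-fold product of the
  Y-marginal of the time average, so the perception constraint on the code becomes one on
  \<open>Q\<close>. Block lengths beyond any \<open>N\<close> are supplied because only long blocks
  tell marginals apart.\<close>

lemma ex_time_average_of_code:
  fixes P :: "('x::finite \<times> 'z::finite) pmf"
  assumes ach: "achievable_strong YZ_iid P D R R0 Dc Pc" and e: "0 < e"
  shows "\<exists>Q n. N \<le> n \<and> map_pmf (\<lambda>(x, y, z). (x, z)) Q = P \<and> cond_MI Q \<le> R + e \<and>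
    measure_pmf.expectation Q (\<lambda>(x, y, z). D x y) \<le> Dc + e \<and>
    tv_dist (iid_pmf n (map_pmf fst P)) (iid_pmf n (map_pmf (\<lambda>t. fst (snd t)) Q)) \<le> Pc + e"
proof -
  define M where "M n = 2 powr (real n * (R + e))" for n
  define M0 where "M0 n = 2 powr (real n * (R0 + e))" for n
  have "\<forall>\<^sub>F n in sequentially. \<exists>f g. valid_code n (M n) (M0 n) f g \<and>
          (let J = code_joint P n (M0 n) f g in YZ_iid n J \<and> code_distortion D n J \<le> Dc + e \<and>
             tv_dist (map_pmf (\<lambda>(xs, zs, k, ys). xs) J) (map_pmf (\<lambda>(xs, zs, k, ys). ys) J) \<le> Pc + e)"
    using ach e unfolding achievable_strong_def M_def M0_def by blast
  then obtain n0 where n0: "\<And>n. n0 \<le> n \<Longrightarrow> \<exists>f g. valid_code n (M n) (M0 n) f g \<and>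
          (let J = code_joint P n (M0 n) f g in YZ_iid n J \<and> code_distortion D n J \<le> Dc + e \<and>
             tv_dist (map_pmf (\<lambda>(xs, zs, k, ys). xs) J) (map_pmf (\<lambda>(xs, zs, k, ys). ys) J) \<le> Pc + e)"
    unfolding eventually_sequentially by blast
  define n where "n = Suc (max n0 N)"
  have n: "0 < n" "N \<le> n" "n0 \<le> n" by (auto simp: n_def)
  obtain f g where code: "valid_code n (M n) (M0 n) f g"
    and J: "YZ_iid n (code_joint P n (M0 n) f g)" "code_distortion D n (code_joint P n (M0 n) f g) \<le> Dc + e"
      "tv_dist (map_pmf (\<lambda>(xs, zs, k, ys). xs) (code_joint P n (M0 n) f g)) (map_pmf (\<lambda>(xs, zs, k, ys). ys) (code_joint P n (M0 n) f g)) \<le> Pc + e"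
    using n0[OF n(3)] unfolding Let_def by blast
  define C where "C = code_joint P n (M0 n) f g"
  define Q where "Q = time_average n C"
  have fin: "finite (set_pmf C)" unfolding C_def by (rule finite_code_joint[OF code])
  have src: "map_pmf (\<lambda>(x, y, z). (x, z)) Q = P" unfolding Q_def C_def by (rule time_average_source[OF n(1)])
  have "real n * cond_MI Q \<le> real n * (R + e)"
  proof -
    have "real (card (idx (M n))) \<le> M n" by (simp add: idx_def M_def)
    then have "log 2 (card (idx (M n))) \<le> log 2 (M n)"
      using card_idx_pos[OF code] by (intro log_mono) auto
    also have "\<dots> = real n * (R + e)" by (simp add: M_def)
    finally show ?thesis using code_rate_bound[OF code n(1), of P] by (simp add: Q_def C_def)
  qed
  then have MI: "cond_MI Q \<le> R + e" using n by simp
  have "real n * measure_pmf.expectation Q (\<lambda>(x, y, z). D x y)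
      = measure_pmf.expectation C (\<lambda>(xs, zs, k, ys). \<Sum>i<n. D (xs ! i) (ys ! i))"
    unfolding Q_def using expectation_time_average[OF n(1) fin, of "\<lambda>(x, y, z). D x y"] by simp
  also have "\<dots> = real n * code_distortion D n C"
    using n by (simp add: code_distortion_def case_prod_unfold)
  finally have dist: "measure_pmf.expectation Q (\<lambda>(x, y, z). D x y) \<le> Dc + e"
    using J(2) n by (simp add: C_def)
  obtain q :: "('x \<times> 'z) pmf" where q: "map_pmf (\<lambda>(xs, zs, k, ys). zip ys zs) C = iid_pmf n q"
    using J(1) unfolding YZ_iid_def C_def by blast
  have Y: "map_pmf (\<lambda>(xs, zs, k, ys). ys) C = iid_pmf n (map_pmf fst q)"
  proof -
    \<comment> \<open>Equal lengths keep \<open>zip\<close> from truncating, so \<open>ys\<close>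
      can be read off the zipped list.\<close>
    have "map_pmf (\<lambda>(xs, zs, k, ys). ys) C = map_pmf (\<lambda>(xs, zs, k, ys). map fst (zip ys zs)) C"
      using length_code_joint[OF code, of _ _ _ _ P] by (intro map_pmf_cong refl) (auto simp: C_def)
    also have "\<dots> = map_pmf (map fst) (map_pmf (\<lambda>(xs, zs, k, ys). zip ys zs) C)"
      by (simp add: map_pmf_comp case_prod_unfold)
    finally show ?thesis by (simp add: q iid_pmf_map)
  qed
  have "map_pmf (\<lambda>t. fst (snd t)) Q = map_pmf fst q"
    unfolding Q_def
  proof (rule map_time_average[OF n(1)])
    fix i assume "i < n"
    then have "map_pmf (\<lambda>ys. ys ! i) (map_pmf (\<lambda>(xs, zs, k, ys). ys) C) = map_pmf fst q"
      unfolding Y by (rule map_nth_iid_pmf)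
    then show "map_pmf (\<lambda>(xs, zs, k, ys). fst (snd (xs ! i, ys ! i, zs ! i))) C = map_pmf fst q"
      by (simp add: map_pmf_comp case_prod_unfold)
  qed
  moreover have "map_pmf (\<lambda>(xs, zs, k, ys). xs) C = iid_pmf n (map_pmf fst P)"
    unfolding C_def using map_code_joint_source[of "\<lambda>xs zs. xs" P n "M0 n" f g] by (simp add: iid_pmf_map)
  ultimately have "tv_dist (iid_pmf n (map_pmf fst P)) (iid_pmf n (map_pmf (\<lambda>t. fst (snd t)) Q)) \<le> Pc + e"
    using J(3) Y by (simp add: C_def)
  with n(2) src MI dist show ?thesis by blast
qed

text \<open>The infimum over rates carries slack, but a subsequence limit of time averages meets all
  constraints exactly. The source marginal is the same along the sequence, so the limit still comes
  from a channel applied to \<open>P\<close>.\<close>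

lemma single_letter_converse:
  fixes P :: "('x::finite \<times> 'z::finite) pmf"
  assumes ach: "achievable_strong YZ_iid P D R R0 Dc Pc"
  shows "\<exists>W. cond_MI (chan_joint P W) \<le> R \<and>
    measure_pmf.expectation (chan_joint P W) (\<lambda>(x, y, z). D x y) \<le> Dc \<and>
    (\<forall>n. tv_dist (iid_pmf n (map_pmf fst P)) (iid_pmf n (map_pmf (\<lambda>t. fst (snd t)) (chan_joint P W))) \<le> Pc)"
proof -
  define \<epsilon> where "\<epsilon> j = inverse (real (Suc j))" for j
  \<comment> \<open>Tying the block length to the slack by \<open>Suc j \<le> n\<close> lets the
    bound \<open>8 / n\<close> be absorbed into \<open>8 * \<epsilon> j\<close> below.\<close>
  have "\<forall>j. \<exists>Q n. Suc j \<le> n \<and> map_pmf (\<lambda>(x, y, z). (x, z)) Q = P \<and> cond_MI Q \<le> R + \<epsilon> j \<and>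
    measure_pmf.expectation Q (\<lambda>(x, y, z). D x y) \<le> Dc + \<epsilon> j \<and>
    tv_dist (iid_pmf n (map_pmf fst P)) (iid_pmf n (map_pmf (\<lambda>t. fst (snd t)) Q)) \<le> Pc + \<epsilon> j"
    using ex_time_average_of_code[OF ach] by (simp add: \<epsilon>_def)
  then obtain Q n where Q: "\<And>j. Suc j \<le> n j" "\<And>j. map_pmf (\<lambda>(x, y, z). (x, z)) (Q j) = P" "\<And>j. cond_MI (Q j) \<le> R + \<epsilon> j"
    "\<And>j. measure_pmf.expectation (Q j) (\<lambda>(x, y, z). D x y) \<le> Dc + \<epsilon> j"
    "\<And>j. tv_dist (iid_pmf (n j) (map_pmf fst P)) (iid_pmf (n j) (map_pmf (\<lambda>t. fst (snd t)) (Q j))) \<le> Pc + \<epsilon> j"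
    by metis
  obtain Q' r where r: "strict_mono (r :: nat \<Rightarrow> nat)" and lim: "\<And>t. (\<lambda>j. pmf (Q (r j)) t) \<longlonglongrightarrow> pmf Q' t"
    using pmf_convergent_subsequence[of Q] by blast
  have limm: "(\<lambda>j. pmf (map_pmf h (Q (r j))) a) \<longlonglongrightarrow> pmf (map_pmf h Q') a" for h :: "_ \<Rightarrow> 'b" and a
    unfolding pmf_map_finite by (intro tendsto_sum lim)
  have \<epsilon>0: "(\<lambda>j. \<epsilon> (r j)) \<longlonglongrightarrow> 0"
    using LIMSEQ_subseq_LIMSEQ[OF LIMSEQ_inverse_real_of_nat r] by (simp add: \<epsilon>_def o_def)
  have \<epsilon>1: "(\<lambda>j. c + \<epsilon> (r j)) \<longlonglongrightarrow> c" for c using tendsto_add[OF tendsto_const[of c] \<epsilon>0] by simp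
  have "map_pmf (\<lambda>(x, y, z). (x, z)) Q' = P"
  proof (rule pmf_eqI)
    fix a
    have "(\<lambda>j. pmf P a) \<longlonglongrightarrow> pmf (map_pmf (\<lambda>(x, y, z). (x, z)) Q') a"
      using limm[of "\<lambda>(x, y, z). (x, z)" a] by (simp add: Q(2))
    then show "pmf (map_pmf (\<lambda>(x, y, z). (x, z)) Q') a = pmf P a" by (simp add: LIMSEQ_const_iff)
  qed
  then obtain W where W: "chan_joint P W = Q'" using ex_channel by blast
  have "cond_MI Q' \<le> R"
    using Q(3) by (intro LIMSEQ_le[OF cond_MI_tendsto[of "\<lambda>j. Q (r j)", OF lim] \<epsilon>1]) auto
  moreover have "measure_pmf.expectation Q' (\<lambda>(x, y, z). D x y) \<le> Dc"
  proof (rule LIMSEQ_le[OF _ \<epsilon>1])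
    have E: "measure_pmf.expectation S (\<lambda>(x, y, z). D x y) = (\<Sum>t\<in>UNIV. (\<lambda>(x, y, z). D x y) t * pmf S t)" for S :: "('x \<times> 'x \<times> 'z) pmf"
      by (rule integral_measure_pmf_real) auto
    show "(\<lambda>j. measure_pmf.expectation (Q (r j)) (\<lambda>(x, y, z). D x y)) \<longlonglongrightarrow> measure_pmf.expectation Q' (\<lambda>(x, y, z). D x y)"
      unfolding E by (intro tendsto_sum tendsto_mult tendsto_const lim)
  qed (use Q(4) in auto)
  moreover have "tv_dist (iid_pmf m (map_pmf fst P)) (iid_pmf m (map_pmf (\<lambda>t. fst (snd t)) Q')) \<le> Pc" for m
  proof (cases "1 \<le> Pc")
    case True
    then show ?thesis using tv_dist_le_1 order_trans by blast
  next
    case False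
    have "0 \<le> Pc"
      using Q(5) tv_dist_nonneg order_trans by (intro LIMSEQ_le_const[OF \<epsilon>1]) blast
    moreover have "map_pmf (\<lambda>t. fst (snd t)) Q' = map_pmf fst P"
    proof (rule pmf_eqI)
      fix a
      let ?d = "\<lambda>j. pmf (map_pmf fst P) a - pmf (map_pmf (\<lambda>t. fst (snd t)) (Q (r j))) a"
      \<comment> \<open>A distance staying below 1 on ever longer blocks squeezes the marginals
        together. For small \<open>j\<close> the first factor may be negative, and the estimate is
        then trivial.\<close>
      have "(1 - (Pc + \<epsilon> j)) * (pmf (map_pmf fst P) a - pmf (map_pmf (\<lambda>t. fst (snd t)) (Q j)) a)\<^sup>2 \<le> 8 * \<epsilon> j" for j
      proof -
        let ?D = "(pmf (map_pmf fst P) a - pmf (map_pmf (\<lambda>t. fst (snd t)) (Q j)) a)\<^sup>2"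
        have n: "0 < real (n j)" "real (Suc j) \<le> real (n j)" using Q(1)[of j] by linarith+
        have "(1 - (Pc + \<epsilon> j)) * (real (n j) * ?D) \<le> 8"
          using Q(5)[of j] by (intro order_trans[OF mult_right_mono tv_dist_iid_ge]) auto
        then have "(1 - (Pc + \<epsilon> j)) * ?D \<le> 8 * inverse (real (n j))" using n by (simp add: field_simps)
        also have "\<dots> \<le> 8 * \<epsilon> j" unfolding \<epsilon>_def using n by (intro mult_left_mono le_imp_inverse_le) auto
        finally show ?thesis .
      qed
      then have "(1 - (Pc + 0)) * (pmf (map_pmf fst P) a - pmf (map_pmf (\<lambda>t. fst (snd t)) Q') a)\<^sup>2 \<le> 8 * 0"
        by (intro LIMSEQ_le[of "\<lambda>j. (1 - (Pc + \<epsilon> (r j))) * (?d j)\<^sup>2" _ "\<lambda>j. 8 * \<epsilon> (r j)"] tendsto_intros \<epsilon>0 limm) auto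
      then have "(pmf (map_pmf fst P) a - pmf (map_pmf (\<lambda>t. fst (snd t)) Q') a)\<^sup>2 \<le> 0"
        using False by (simp add: mult_le_0_iff)
      then show "pmf (map_pmf (\<lambda>t. fst (snd t)) Q') a = pmf (map_pmf fst P) a" by simp
    qed
    ultimately show ?thesis by (simp add: tv_dist_self)
  qed
  ultimately show ?thesis using W by blast
qed

theorem theorem4:
  fixes P :: "('x::finite \<times> 'z::finite) pmf"
    and D :: "'x \<Rightarrow> 'x \<Rightarrow> real"
    and dmax Dc Pc :: real
  assumes "\<And>x y. 0 \<le> D x y \<and> D x y \<le> dmax"
  shows "RDP_strong (\<lambda>n J. True) P D Dc Pc \<le> RDP_single_letter P D Dc Pc \<and>
         RDP_strong YZ_iid P D Dc Pc = RDP_single_letter P D Dc Pc"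
proof -
  have "RDP_strong YZ_iid P D Dc Pc \<le> RDP_single_letter P D Dc Pc"
    unfolding RDP_single_letter_def
  proof (rule Inf_greatest)
    fix v assume "v \<in> {ereal (cond_MI (chan_joint P W)) | W :: 'x \<Rightarrow> 'z \<Rightarrow> 'x pmf.
           measure_pmf.expectation (chan_joint P W) (\<lambda>(x, y, z). D x y) \<le> Dc \<and>
           limsup (\<lambda>n. ereal (tv_dist (iid_pmf n (map_pmf fst P))
                                     (iid_pmf n (map_pmf (\<lambda>t. fst (snd t)) (chan_joint P W)))))
             \<le> ereal Pc}"
    then obtain W where v: "v = ereal (cond_MI (chan_joint P W))"
      and ED: "measure_pmf.expectation (chan_joint P W) (\<lambda>(x, y, z). D x y) \<le> Dc"
      and tv: "limsup (\<lambda>n. ereal (tv_dist (iid_pmf n (map_pmf fst P))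
                                     (iid_pmf n (map_pmf (\<lambda>t. fst (snd t)) (chan_joint P W))))) \<le> ereal Pc"
      by blast
    have "achievable_strong YZ_iid P D (cond_MI (chan_joint P W)) (2 * log 2 CARD('x)) Dc Pc"
      by (rule achievable_strong_cond_MI[OF assms ED tv_dist_iid_le_of_limsup[OF tv]])
    moreover have "0 \<le> 2 * log 2 (real CARD('x))" by (simp add: Suc_le_eq)
    ultimately show "RDP_strong YZ_iid P D Dc Pc \<le> v"
      unfolding RDP_strong_def v by (intro Inf_lower) blast
  qed
  moreover have "RDP_single_letter P D Dc Pc \<le> RDP_strong YZ_iid P D Dc Pc"
    unfolding RDP_strong_def
  proof (rule Inf_greatest)
    fix v assume "v \<in> {ereal R | R. \<exists>R0\<ge>0. achievable_strong YZ_iid P D R R0 Dc Pc}"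
    then obtain R R0 where v: "v = ereal R" and "achievable_strong YZ_iid P D R R0 Dc Pc" by blast
    from single_letter_converse[OF this(2)] obtain W where W: "cond_MI (chan_joint P W) \<le> R"
      "measure_pmf.expectation (chan_joint P W) (\<lambda>(x, y, z). D x y) \<le> Dc"
      "\<And>n. tv_dist (iid_pmf n (map_pmf fst P)) (iid_pmf n (map_pmf (\<lambda>t. fst (snd t)) (chan_joint P W))) \<le> Pc"
      by blast
    have "limsup (\<lambda>n. ereal (tv_dist (iid_pmf n (map_pmf fst P))
       (iid_pmf n (map_pmf (\<lambda>t. fst (snd t)) (chan_joint P W))))) \<le> ereal Pc"
      using W(3) by (intro Limsup_bounded) auto
    then have "RDP_single_letter P D Dc Pc \<le> ereal (cond_MI (chan_joint P W))"
      unfolding RDP_single_letter_def using W(2) by (intro Inf_lower) blast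
    also have "\<dots> \<le> v" using W(1) v by simp
    finally show "RDP_single_letter P D Dc Pc \<le> v" .
  qed
  \<comment> \<open>Dropping the restriction only enlarges the set of achievable rates, so
    unrestricted codes inherit the upper bound.\<close>
  moreover have "RDP_strong (\<lambda>n J. True) P D Dc Pc \<le> RDP_strong YZ_iid P D Dc Pc"
  proof -
    have "achievable_strong (\<lambda>n J. True) P D R R0 Dc Pc" if "achievable_strong YZ_iid P D R R0 Dc Pc" for R R0
      using that unfolding achievable_strong_def Let_def by (fast elim!: eventually_mono)
    then show ?thesis unfolding RDP_strong_def by (intro Inf_superset_mono) blast
  qed
  ultimately show ?thesis by simp
qed

end
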